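(* Let $f\colon\{0,1\}^m\to\{0,1\}$ and $g\colon\{0,1\}^n\to\{0,1\}$ be non-constant Boolean functions. Then \[L(f\circ g)^{1+O\left(\frac{1}{\sqrt{\log L(f\circ g)}}\right)}\ge\frac{1}{O(m^4)}\cdot\left(L(f)-O(1)\right)\cdot\mathrm{Adv}_s(g).\]
   Context: The block-composition $f\circ g\colon(\{0,1\}^n)^m\to\{0,1\}$ is $(f\circ g)(x_1,\dots,x_m)=f(g(x_1),\dots,g(x_m))$. $L(h)$ is the minimal number of leaves of a De Morgan formula (binary tree, leaves labeled by literals, internal nodes AND/OR) computing $h$. The soft-adversary bound $\mathrm{Adv}_s(g)$ is the maximum, over all distributions $(\mathbf{a},\mathbf{b})$ supported on $g^{-1}(1)\times g^{-1}(0)$, of $\min_{a\in\mathrm{supp}\,\mathbf{a},i\in[n]}\frac{1}{\Pr[\mathbf{a}_i\ne\mathbf{b}_i\mid\mathbf{a}=a]}\cdot\min_{b\in\mathrm{supp}\,\mathbf{b},i\in[n]}\frac{1}{\Pr[\mathbf{a}_i\ne\mathbf{b}_i\mid\mathbf{b}=b]}$. Logarithms are base 2; $O(\cdot)$ hides absolute constants. *)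

theory Defs
  imports "HOL-Probability.Probability"
begin

datatype (vars: 'v) formula =
    Lit 'v bool
  | And "'v formula" "'v formula"
  | Or "'v formula" "'v formula"

text \<open>\<^term>\<open>Lit v True\<close> is the literal \<open>v\<close>, \<^term>\<open>Lit v False\<close> is its negation.\<close>

primrec eval_formula :: "'v formula \<Rightarrow> ('v \<Rightarrow> bool) \<Rightarrow> bool" where
  "eval_formula (Lit v s) x = (x v = s)"
| "eval_formula (And \<phi> \<psi>) x = (eval_formula \<phi> x \<and> eval_formula \<psi> x)"
| "eval_formula (Or \<phi> \<psi>) x = (eval_formula \<phi> x \<or> eval_formula \<psi> x)"

primrec leaves :: "'v formula \<Rightarrow> nat" where
  "leaves (Lit v s) = 1"
| "leaves (And \<phi> \<psi>) = leaves \<phi> + leaves \<psi>"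
| "leaves (Or \<phi> \<psi>) = leaves \<phi> + leaves \<psi>"

text \<open>The Boolean cube with coordinates indexed by \<open>I\<close>. The cube of dimension \<open>n\<close> is \<open>cube {..<n}\<close>,
  and a Boolean function on it is a function of which only the values on this set matter.\<close>

definition cube :: "'v set \<Rightarrow> ('v \<Rightarrow> bool) set" where
  "cube I = (I \<rightarrow>\<^sub>E UNIV)"

definition computes :: "'v set \<Rightarrow> 'v formula \<Rightarrow> (('v \<Rightarrow> bool) \<Rightarrow> bool) \<Rightarrow> bool" where
  "computes I \<phi> h \<longleftrightarrow> vars \<phi> \<subseteq> I \<and> (\<forall>x \<in> cube I. eval_formula \<phi> x = h x)"

definition formula_complexity :: "'v set \<Rightarrow> (('v \<Rightarrow> bool) \<Rightarrow> bool) \<Rightarrow> nat" where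
  "formula_complexity I h = (LEAST k. \<exists>\<phi>. computes I \<phi> h \<and> leaves \<phi> = k)"

text \<open>The input \<open>(x\<^sub>1, \<dots>, x\<^sub>m)\<close> is encoded as a point of \<open>cube ({..<m} \<times> {..<n})\<close>,
  whose coordinate \<open>(i, j)\<close> is the \<open>j\<close>-th bit of \<open>x\<^sub>i\<close>.\<close>

definition block_comp ::
  "nat \<Rightarrow> nat \<Rightarrow> ((nat \<Rightarrow> bool) \<Rightarrow> bool) \<Rightarrow> ((nat \<Rightarrow> bool) \<Rightarrow> bool) \<Rightarrow> (nat \<times> nat \<Rightarrow> bool) \<Rightarrow> bool" where
  "block_comp m n f g x = f (\<lambda>i\<in>{..<m}. g (\<lambda>j\<in>{..<n}. x (i, j)))"

text \<open>The two minima are taken in \<^typ>\<open>ereal\<close>, where \<open>1 / 0 = \<infinity>\<close>: coordinates on which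
  \<open>a\<close> and \<open>b\<close> never differ do not contribute to the minimum (in \<^typ>\<open>real\<close> they would
  make it \<open>0\<close>).\<close>

definition soft_adv_value :: "'v set \<Rightarrow> (('v \<Rightarrow> bool) \<times> ('v \<Rightarrow> bool)) pmf \<Rightarrow> ereal" where
  "soft_adv_value I p =
     (INF a \<in> set_pmf (map_pmf fst p). INF i \<in> I.
        1 / ereal (\<P>(z in measure_pmf p. fst z i \<noteq> snd z i \<bar> fst z = a))) *
     (INF b \<in> set_pmf (map_pmf snd p). INF i \<in> I.
        1 / ereal (\<P>(z in measure_pmf p. fst z i \<noteq> snd z i \<bar> snd z = b)))"

definition soft_adv :: "'v set \<Rightarrow> (('v \<Rightarrow> bool) \<Rightarrow> bool) \<Rightarrow> ereal" where
  "soft_adv I g =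
     (SUP p \<in> {p. set_pmf p \<subseteq> {a \<in> cube I. g a} \<times> {b \<in> cube I. \<not> g b}}. soft_adv_value I p)"

end

theory Submission
  imports Defs
begin

text \<open>
  Take a formula for \<open>f \<circ> g\<close> and replace each block of inputs independently by a random pair \<open>(a, b)\<close> drawn from
  a soft-adversary distribution for \<open>g\<close>, so that block \<open>i\<close> reads \<open>a\<close> or \<open>b\<close> according to a fresh variable \<open>y\<^sub>i\<close>; with
  probability \<open>1/(2m)\<close> the variable \<open>y\<^sub>i\<close> is moreover fixed at random. With probability at least \<open>1/2\<close> nothing is fixed
  and the projected formula computes \<open>f\<close>. It therefore suffices that formulas shrink by a factor of order
  \<open>m\<^sup>4 / Adv\<^sub>s(g)\<close> in expectation.

  A Khrapchenko-type argument shows that a subformula with \<open>s\<close> leaves becomes a literal with probability at most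
  \<open>\<theta> sqrt s\<close>, where \<open>\<theta>\<^sup>2\<close> is of order \<open>m\<^sup>4 / Adv\<^sub>s(g)\<close>. The occasional fixing of the \<open>y\<^sub>i\<close> makes this true conditionally on
  every event that is closed under fixing variables. Following Hastad, the size of a projected formula is at most
  twice the number of gates at which one child is a literal and the other is not constant after setting that literal;
  that one child is a literal is a closed event for the other blocks, so the two probabilities multiply.
  Summing over the gates of a formula of depth \<open>D\<close> gives \<open>O(D\<^sup>2 \<theta>\<^sup>2 s)\<close>, and the factor \<open>D\<^sup>2\<close> is absorbed into the exponent
  by balancing the formula to size \<open>L 2\<^bsup>t\<^esup>\<close> and depth \<open>O(2\<^bsup>t\<^esup> log L)\<close> with \<open>t = sqrt (log L)\<close>.
\<close>

section \<open>Formulas and formula complexity\<close>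

lemma leaves_pos: "leaves \<phi> \<ge> 1"
  by (induction \<phi>) auto

lemma eval_formula_cong: "(\<And>v. v \<in> vars \<phi> \<Longrightarrow> x v = y v) \<Longrightarrow> eval_formula \<phi> x = eval_formula \<phi> y"
  by (induction \<phi>) auto

lemma nonconstant_cube_pos: "\<not> f constant_on cube {..<m :: nat} \<Longrightarrow> m > 0"
  by (rule ccontr) (auto simp: cube_def constant_on_def)

primrec depth :: "'v formula \<Rightarrow> nat" where
  "depth (Lit v s) = 0"
| "depth (And \<phi> \<psi>) = Suc (max (depth \<phi>) (depth \<psi>))"
| "depth (Or \<phi> \<psi>) = Suc (max (depth \<phi>) (depth \<psi>))"

text \<open>Shannon expansion, one coordinate at a time. There are no constant leaves, so the base
  case writes a constant as a variable combined with its negation, which is where \<open>I\<close>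
  being nonempty enters.\<close>

lemma ex_formula:
  assumes "finite I" "I \<noteq> {}"
  shows "\<exists>\<phi>. vars \<phi> \<subseteq> I \<and> (\<forall>x. eval_formula \<phi> x = h (restrict x I))"
  using assms
proof (induction I arbitrary: h rule: finite_ne_induct)
  case (singleton i)
  let ?h = "\<lambda>s. h (restrict (\<lambda>_. s) {i})"
  have r: "restrict x {i} = restrict (\<lambda>_. x i) {i}" for x :: "'a \<Rightarrow> bool"
    by (auto simp: restrict_def)
  define \<phi> where "\<phi> = (if ?h True then if ?h False then Or (Lit i True) (Lit i False) else Lit i True
     else if ?h False then Lit i False else And (Lit i True) (Lit i False))"
  have "vars \<phi> \<subseteq> {i}" by (auto simp: \<phi>_def)
  moreover have "eval_formula \<phi> x = h (restrict x {i})" for x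
    unfolding r[of x] by (cases "x i") (auto simp: \<phi>_def)
  ultimately show ?case by blast
next
  case (insert i I)
  have r: "restrict x (insert i I) = (restrict x I)(i := x i)" for x :: "'a \<Rightarrow> bool"
    by (auto simp: restrict_def fun_eq_iff)
  obtain \<phi> where \<phi>: "vars \<phi> \<subseteq> I" "\<And>x. eval_formula \<phi> x = h ((restrict x I)(i := True))"
    using insert.IH[of "\<lambda>x. h (x(i := True))"] by blast
  obtain \<psi> where \<psi>: "vars \<psi> \<subseteq> I" "\<And>x. eval_formula \<psi> x = h ((restrict x I)(i := False))"
    using insert.IH[of "\<lambda>x. h (x(i := False))"] by blast
  let ?\<eta> = "Or (And (Lit i True) \<phi>) (And (Lit i False) \<psi>)"
  have "eval_formula ?\<eta> x = h (restrict x (insert i I))" for x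
    unfolding r by (cases "x i") (auto simp: \<phi> \<psi>)
  moreover have "vars ?\<eta> \<subseteq> insert i I" using \<phi> \<psi> by auto
  ultimately show ?case by blast
qed

text \<open>\<open>LEAST\<close> is meaningful only once some formula computes \<open>h\<close>;
  \<open>ex_formula\<close> supplies one, and \<open>restrict\<close> is the identity on the
  cube.\<close>

lemma formula_complexity_attained:
  assumes "finite I" "I \<noteq> {}"
  obtains \<phi> where "computes I \<phi> h" "leaves \<phi> = formula_complexity I h"
proof -
  obtain \<phi> where "vars \<phi> \<subseteq> I" "\<forall>x. eval_formula \<phi> x = h (restrict x I)"
    using ex_formula[OF assms] by blast
  hence "computes I \<phi> h"
    unfolding computes_def cube_def by (metis PiE_restrict)
  hence "\<exists>k \<phi>. computes I \<phi> h \<and> leaves \<phi> = k" by blast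
  from LeastI_ex[OF this] show ?thesis
    unfolding formula_complexity_def[symmetric] using that by blast
qed

lemma formula_complexity_le: "computes I \<phi> h \<Longrightarrow> formula_complexity I h \<le> leaves \<phi>"
  unfolding formula_complexity_def by (rule Least_le) blast

section \<open>Balancing formulas\<close>

text \<open>\<open>None\<close> is an absent operand. It acts as the neutral constant (true here,
  false in \<open>or_opt\<close>) and costs no leaf.\<close>

definition and_opt :: "'v formula \<Rightarrow> 'v formula option \<Rightarrow> 'v formula" where
  "and_opt \<psi> \<alpha> = (case \<alpha> of None \<Rightarrow> \<psi> | Some \<alpha>' \<Rightarrow> And \<psi> \<alpha>')"

definition or_opt :: "'v formula \<Rightarrow> 'v formula option \<Rightarrow> 'v formula" where
  "or_opt \<psi> \<beta> = (case \<beta> of None \<Rightarrow> \<psi> | Some \<beta>' \<Rightarrow> Or \<psi> \<beta>')"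

text \<open>Variables may disappear but not appear, so that \<open>computes\<close> passes from
  \<phi> to \<psi> for every index set.\<close>

definition equivalent :: "'v formula \<Rightarrow> 'v formula \<Rightarrow> bool" where
  "equivalent \<phi> \<psi> \<longleftrightarrow> vars \<psi> \<subseteq> vars \<phi> \<and> (\<forall>x. eval_formula \<psi> x = eval_formula \<phi> x)"

text \<open>Descend from the root into a child with more than \<open>t\<close> leaves until both
  children are light. Negations sit only at the leaves, so \<phi> is monotone in the value of the
  gate \<psi> reached and has the form \<open>(\<psi> \<and> \<alpha>) \<or> \<beta>\<close>, with
  \<alpha> and \<beta> built from leaves outside \<psi>.\<close>

lemma heavy_gate_decomposition:
  fixes t :: real
  assumes "t \<ge> 1" "real (leaves \<phi>) > t"
  shows "\<exists>\<psi>\<^sub>1 \<psi>\<^sub>2 \<psi> \<alpha> \<beta>. (\<psi> = And \<psi>\<^sub>1 \<psi>\<^sub>2 \<or> \<psi> = Or \<psi>\<^sub>1 \<psi>\<^sub>2) \<and> leaves \<psi>\<^sub>1 \<le> t \<and> leaves \<psi>\<^sub>2 \<le> t \<and>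
    real (leaves \<psi>) > t \<and> leaves \<psi> \<le> leaves \<phi> \<and>
    equivalent \<phi> (or_opt (and_opt \<psi> \<alpha>) \<beta>) \<and>
    (\<forall>\<gamma>. \<alpha> = Some \<gamma> \<or> \<beta> = Some \<gamma> \<longrightarrow> leaves \<psi> + leaves \<gamma> \<le> leaves \<phi>)"
    (is "?P \<phi>")
proof -
  have base: "?P \<phi>" if "\<phi> = And \<psi>\<^sub>1 \<psi>\<^sub>2 \<or> \<phi> = Or \<psi>\<^sub>1 \<psi>\<^sub>2" "leaves \<psi>\<^sub>1 \<le> t" "leaves \<psi>\<^sub>2 \<le> t"
    "real (leaves \<phi>) > t" for \<phi> \<psi>\<^sub>1 \<psi>\<^sub>2 :: "'a formula"
    using that by (intro exI[of _ \<psi>\<^sub>1] exI[of _ \<psi>\<^sub>2] exI[of _ \<phi>] exI[of _ None])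
      (auto simp: and_opt_def or_opt_def equivalent_def)
  have stepA: "?P \<phi>" if "?P \<eta>" "\<phi> = And \<eta> \<rho> \<or> \<phi> = And \<rho> \<eta>" for \<phi> \<eta> \<rho> :: "'a formula"
  proof -
    from that(1) obtain \<psi>\<^sub>1 \<psi>\<^sub>2 \<psi> \<alpha> \<beta> where *: "\<psi> = And \<psi>\<^sub>1 \<psi>\<^sub>2 \<or> \<psi> = Or \<psi>\<^sub>1 \<psi>\<^sub>2" "leaves \<psi>\<^sub>1 \<le> t" "leaves \<psi>\<^sub>2 \<le> t"
      "real (leaves \<psi>) > t" "leaves \<psi> \<le> leaves \<eta>"
      "equivalent \<eta> (or_opt (and_opt \<psi> \<alpha>) \<beta>)"
      "\<forall>\<gamma>. \<alpha> = Some \<gamma> \<or> \<beta> = Some \<gamma> \<longrightarrow> leaves \<psi> + leaves \<gamma> \<le> leaves \<eta>" by blast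
    \<comment> \<open>The sibling \<rho> is copied into both \<alpha> and \<beta>; each of the two
      alone still uses every outside leaf at most once, so their sizes are bounded
      separately.\<close>
    have e: "equivalent \<phi> (or_opt (and_opt \<psi> (Some (and_opt \<rho> \<alpha>))) (map_option (And \<rho>) \<beta>))"
      using *(6) that(2)
      by (cases \<alpha>; cases \<beta>) (auto simp: and_opt_def or_opt_def equivalent_def)
    have l: "\<forall>\<gamma>. Some (and_opt \<rho> \<alpha>) = Some \<gamma> \<or> map_option (And \<rho>) \<beta> = Some \<gamma> \<longrightarrow> leaves \<psi> + leaves \<gamma> \<le> leaves \<phi>"
      using *(5,7) that(2)
      by (cases \<alpha>; cases \<beta>) (auto simp: and_opt_def)
    have "leaves \<psi> \<le> leaves \<phi>" using *(5) that(2) by auto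
    thus ?thesis using *(1-4) e l by blast
  qed
  have stepO: "?P \<phi>" if "?P \<eta>" "\<phi> = Or \<eta> \<rho> \<or> \<phi> = Or \<rho> \<eta>" for \<phi> \<eta> \<rho> :: "'a formula"
  proof -
    from that(1) obtain \<psi>\<^sub>1 \<psi>\<^sub>2 \<psi> \<alpha> \<beta> where *: "\<psi> = And \<psi>\<^sub>1 \<psi>\<^sub>2 \<or> \<psi> = Or \<psi>\<^sub>1 \<psi>\<^sub>2" "leaves \<psi>\<^sub>1 \<le> t" "leaves \<psi>\<^sub>2 \<le> t"
      "real (leaves \<psi>) > t" "leaves \<psi> \<le> leaves \<eta>"
      "equivalent \<eta> (or_opt (and_opt \<psi> \<alpha>) \<beta>)"
      "\<forall>\<gamma>. \<alpha> = Some \<gamma> \<or> \<beta> = Some \<gamma> \<longrightarrow> leaves \<psi> + leaves \<gamma> \<le> leaves \<eta>" by blast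
    have e: "equivalent \<phi> (or_opt (and_opt \<psi> \<alpha>) (Some (or_opt \<rho> \<beta>)))"
      using *(6) that(2)
      by (cases \<alpha>; cases \<beta>) (auto simp: and_opt_def or_opt_def equivalent_def)
    have l: "\<forall>\<gamma>. \<alpha> = Some \<gamma> \<or> Some (or_opt \<rho> \<beta>) = Some \<gamma> \<longrightarrow> leaves \<psi> + leaves \<gamma> \<le> leaves \<phi>"
      using *(5,7) that(2)
      by (cases \<alpha>; cases \<beta>) (auto simp: or_opt_def)
    have "leaves \<psi> \<le> leaves \<phi>" using *(5) that(2) by auto
    thus ?thesis using *(1-4) e l by blast
  qed
  from assms(2) show ?thesis
  proof (induction \<phi>)
    case (Lit v s)
    then show ?case using assms(1) by simp
  next
    case (And \<phi>1 \<phi>2)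
    show ?case
    proof (cases "real (leaves \<phi>1) > t")
      case True
      show ?thesis by (rule stepA[OF And.IH(1)[OF True]]) blast
    next
      case F1: False
      show ?thesis
      proof (cases "real (leaves \<phi>2) > t")
        case True
        show ?thesis by (rule stepA[OF And.IH(2)[OF True]]) blast
      next
        case False
        show ?thesis using F1 False And.prems by (intro base[of _ \<phi>1 \<phi>2]) auto
      qed
    qed
  next
    case (Or \<phi>1 \<phi>2)
    show ?case
    proof (cases "real (leaves \<phi>1) > t")
      case True
      show ?thesis by (rule stepO[OF Or.IH(1)[OF True]]) blast
    next
      case F1: False
      show ?thesis
      proof (cases "real (leaves \<phi>2) > t")
        case True
        show ?thesis by (rule stepO[OF Or.IH(2)[OF True]]) blast
      next
        case False
        show ?thesis using F1 False Or.prems by (intro base[of _ \<phi>1 \<phi>2]) auto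
      qed
    qed
  qed
qed

text \<open>Recursion on the decomposition with threshold \<open>(1 - 1/k) S\<close>. A level costs
  three gates of depth and shrinks sizes by the factor \<open>1 - 1/k\<close>, which gives depth
  \<open>3 k ln S\<close>. The leaves outside the heavy gate are duplicated, but there are at most
  \<open>S/k\<close> of them, and \<open>k powr \<epsilon> \<ge> 2\<close> absorbs the
  doubling.\<close>

theorem formula_balancing:
  fixes k \<epsilon> :: real and \<phi> :: "'v formula"
  assumes k: "k \<ge> 2" and \<epsilon>: "\<epsilon> \<ge> 0" "k powr \<epsilon> \<ge> 2"
  shows "\<exists>\<phi>'. equivalent \<phi> \<phi>' \<and> real (leaves \<phi>') \<le> real (leaves \<phi>) * real (leaves \<phi>) powr \<epsilon> \<and>
    real (depth \<phi>') \<le> 3 * k * ln (leaves \<phi>)"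
proof (induction "leaves \<phi>" arbitrary: \<phi> rule: less_induct)
  case less
  let ?S = "real (leaves \<phi>)"
  show ?case
  proof (cases "leaves \<phi> = 1")
    case True
    hence "depth \<phi> = 0"
    proof (cases \<phi>)
      case (And \<psi> \<psi>')
      with True leaves_pos[of \<psi>] leaves_pos[of \<psi>'] show ?thesis by simp
    next
      case (Or \<psi> \<psi>')
      with True leaves_pos[of \<psi>] leaves_pos[of \<psi>'] show ?thesis by simp
    qed simp
    thus ?thesis using True by (intro exI[of _ \<phi>]) (auto simp: equivalent_def)
  next
    case False
    hence S2: "?S \<ge> 2" using leaves_pos[of \<phi>] by linarith
    define t where "t = (1 - 1 / k) * ?S"
    have t: "t \<ge> 1" "t < ?S"
    proof -
      have "1 / k \<le> 1 / 2" "1 / k > 0" using k by (auto simp: field_simps)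
      hence "(1 / 2) * 2 \<le> t" unfolding t_def using S2 by (intro mult_mono) auto
      thus "t \<ge> 1" by simp
      have "(1 - 1 / k) * ?S < 1 * ?S" using S2 \<open>1 / k > 0\<close> by (intro mult_strict_right_mono) auto
      thus "t < ?S" by (simp add: t_def)
    qed
    obtain \<psi>\<^sub>1 \<psi>\<^sub>2 \<psi> \<alpha> \<beta> where d: "\<psi> = And \<psi>\<^sub>1 \<psi>\<^sub>2 \<or> \<psi> = Or \<psi>\<^sub>1 \<psi>\<^sub>2" "leaves \<psi>\<^sub>1 \<le> t" "leaves \<psi>\<^sub>2 \<le> t"
      "real (leaves \<psi>) > t" "leaves \<psi> \<le> leaves \<phi>"
      "equivalent \<phi> (or_opt (and_opt \<psi> \<alpha>) \<beta>)"
      "\<And>\<gamma>. \<alpha> = Some \<gamma> \<or> \<beta> = Some \<gamma> \<Longrightarrow> leaves \<psi> + leaves \<gamma> \<le> leaves \<phi>"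
      using heavy_gate_decomposition[OF t] by blast
    define z where "z = ?S - leaves \<psi>"
    have z: "z \<ge> 0" "z \<le> ?S / k" using d(4,5) by (auto simp: z_def t_def field_simps)
    have lS: "?S = leaves \<psi>\<^sub>1 + leaves \<psi>\<^sub>2 + z" using d(1) by (auto simp: z_def)
    have zt: "z \<le> t"
    proof -
      have "?S / k \<le> ?S * (1 - 1/k)" using k S2 by (simp add: field_simps)
      thus ?thesis using z by (simp add: t_def mult.commute)
    qed
    \<comment> \<open>Three levels are reserved for the heavy gate, \<open>and_opt\<close> and
      \<open>or_opt\<close>; \<open>ln (1 - 1/k) \<le> - 1/k\<close> keeps the recursive parts
      within the rest.\<close>
    define B where "B = 3 * k * ln ?S - 3"
    have *: "\<exists>\<gamma>'. equivalent \<gamma> \<gamma>' \<and> real (leaves \<gamma>') \<le> leaves \<gamma> * real (leaves \<gamma>) powr \<epsilon> \<and> real (depth \<gamma>') \<le> B"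
      if \<gamma>: "leaves \<gamma> \<le> t" for \<gamma> :: "'v formula"
    proof -
      have "leaves \<gamma> < leaves \<phi>" using \<gamma> t by linarith
      from less[OF this] obtain \<gamma>' where g: "equivalent \<gamma> \<gamma>'" "real (leaves \<gamma>') \<le> leaves \<gamma> * real (leaves \<gamma>) powr \<epsilon>"
        "real (depth \<gamma>') \<le> 3 * k * ln (leaves \<gamma>)" by blast
      have "ln (leaves \<gamma>) \<le> ln t" using \<gamma> leaves_pos[of \<gamma>] t by (subst ln_le_cancel_iff) auto
      also have "ln t = ln (1 - 1/k) + ln ?S" unfolding t_def using k S2 by (subst ln_mult) (auto simp: field_simps)
      also have "ln (1 - 1/k) \<le> - 1 / k" using ln_add_one_self_le_self2[of "- 1 / k"] k by (simp add: field_simps)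
      finally have "3 * k * ln (leaves \<gamma>) \<le> 3 * k * (- 1 / k + ln ?S)" using k by (intro mult_left_mono) auto
      also have "\<dots> = B" using k by (simp add: B_def field_simps)
      finally show ?thesis using g by force
    qed
    \<comment> \<open>The factor 1/2 pays for \<alpha> and \<beta> being built from the same
      \<open>z\<close> leaves.\<close>
    have sm: "\<exists>\<gamma>'. equivalent \<gamma> \<gamma>' \<and> real (leaves \<gamma>') \<le> z * ?S powr \<epsilon> / 2 \<and> real (depth \<gamma>') \<le> B"
      if \<gamma>: "leaves \<psi> + leaves \<gamma> \<le> leaves \<phi>" for \<gamma> :: "'v formula"
    proof -
      have lz: "real (leaves \<gamma>) \<le> z" using \<gamma> by (simp add: z_def)
      obtain \<gamma>' where g: "equivalent \<gamma> \<gamma>'" "real (leaves \<gamma>') \<le> leaves \<gamma> * real (leaves \<gamma>) powr \<epsilon>"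
        "real (depth \<gamma>') \<le> B" using *[of \<gamma>] lz zt by auto
      have "real (leaves \<gamma>) powr \<epsilon> \<le> (?S / k) powr \<epsilon>"
        using lz z \<epsilon> by (intro powr_mono2) auto
      also have "\<dots> = ?S powr \<epsilon> / k powr \<epsilon>" using k by (simp add: powr_divide)
      also have "\<dots> \<le> ?S powr \<epsilon> / 2" using \<epsilon> by (intro divide_left_mono) auto
      finally have "leaves \<gamma> * real (leaves \<gamma>) powr \<epsilon> \<le> z * (?S powr \<epsilon> / 2)"
        using lz by (intro mult_mono) auto
      thus ?thesis using g by force
    qed
    have big: "\<exists>\<gamma>'. equivalent \<gamma> \<gamma>' \<and> real (leaves \<gamma>') \<le> leaves \<gamma> * ?S powr \<epsilon> \<and> real (depth \<gamma>') \<le> B"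
      if \<gamma>: "leaves \<gamma> \<le> t" for \<gamma> :: "'v formula"
    proof -
      obtain \<gamma>' where g: "equivalent \<gamma> \<gamma>'" "real (leaves \<gamma>') \<le> leaves \<gamma> * real (leaves \<gamma>) powr \<epsilon>"
        "real (depth \<gamma>') \<le> B" using *[OF \<gamma>] by auto
      have "leaves \<gamma> * real (leaves \<gamma>) powr \<epsilon> \<le> leaves \<gamma> * ?S powr \<epsilon>"
        using \<gamma> t \<epsilon> by (intro mult_left_mono powr_mono2) auto
      thus ?thesis using g by force
    qed
    have opt: "\<exists>\<gamma>'. rel_option equivalent \<gamma> \<gamma>' \<and>
        (\<forall>\<delta>. \<gamma>' = Some \<delta> \<longrightarrow> real (leaves \<delta>) \<le> z * ?S powr \<epsilon> / 2 \<and> real (depth \<delta>) \<le> B)"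
      if "\<gamma> = \<alpha> \<or> \<gamma> = \<beta>" for \<gamma>
    proof (cases \<gamma>)
      case (Some \<delta>)
      with d(7)[of \<delta>] that sm[of \<delta>] obtain \<delta>' where "equivalent \<delta> \<delta>'" "real (leaves \<delta>') \<le> z * ?S powr \<epsilon> / 2"
        "real (depth \<delta>') \<le> B" by auto
      thus ?thesis using Some by (intro exI[of _ "Some \<delta>'"]) auto
    qed auto
    obtain \<alpha>' where \<alpha>': "rel_option equivalent \<alpha> \<alpha>'"
        "\<And>\<delta>. \<alpha>' = Some \<delta> \<Longrightarrow> real (leaves \<delta>) \<le> z * ?S powr \<epsilon> / 2 \<and> real (depth \<delta>) \<le> B"
      using opt[of \<alpha>] by blast
    obtain \<beta>' where \<beta>': "rel_option equivalent \<beta> \<beta>'"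
        "\<And>\<delta>. \<beta>' = Some \<delta> \<Longrightarrow> real (leaves \<delta>) \<le> z * ?S powr \<epsilon> / 2 \<and> real (depth \<delta>) \<le> B"
      using opt[of \<beta>] by blast
    obtain \<eta>\<^sub>1 where \<eta>1: "equivalent \<psi>\<^sub>1 \<eta>\<^sub>1" "real (leaves \<eta>\<^sub>1) \<le> leaves \<psi>\<^sub>1 * ?S powr \<epsilon>" "real (depth \<eta>\<^sub>1) \<le> B"
      using big[OF d(2)] by blast
    obtain \<eta>\<^sub>2 where \<eta>2: "equivalent \<psi>\<^sub>2 \<eta>\<^sub>2" "real (leaves \<eta>\<^sub>2) \<le> leaves \<psi>\<^sub>2 * ?S powr \<epsilon>" "real (depth \<eta>\<^sub>2) \<le> B"
      using big[OF d(3)] by blast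
    obtain \<eta> where \<eta>: "equivalent \<psi> \<eta>" "real (leaves \<eta>) = leaves \<eta>\<^sub>1 + leaves \<eta>\<^sub>2" "real (depth \<eta>) \<le> B + 1"
    proof (cases "\<psi> = And \<psi>\<^sub>1 \<psi>\<^sub>2")
      case True
      show ?thesis using True \<eta>1 \<eta>2 by (intro that[of "And \<eta>\<^sub>1 \<eta>\<^sub>2"]) (auto simp: equivalent_def)
    next
      case False
      hence "\<psi> = Or \<psi>\<^sub>1 \<psi>\<^sub>2" using d by auto
      thus ?thesis using \<eta>1 \<eta>2 by (intro that[of "Or \<eta>\<^sub>1 \<eta>\<^sub>2"]) (auto simp: equivalent_def)
    qed
    let ?\<phi>' = "or_opt (and_opt \<eta> \<alpha>') \<beta>'"
    have eq: "equivalent \<phi> ?\<phi>'"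
      using d(6) \<eta>(1) \<alpha>'(1) \<beta>'(1)
      by (cases \<alpha>; cases \<beta>; cases \<alpha>'; cases \<beta>') (auto simp: and_opt_def or_opt_def equivalent_def)
    have nn: "0 \<le> z * ?S powr \<epsilon> / 2" using z by simp
    have "real (leaves ?\<phi>') \<le> leaves \<eta> + z * ?S powr \<epsilon> / 2 + z * ?S powr \<epsilon> / 2"
      using \<alpha>'(2) \<beta>'(2) nn by (cases \<alpha>'; cases \<beta>') (auto simp: and_opt_def or_opt_def; force)+
    also have "\<dots> \<le> leaves \<psi>\<^sub>1 * ?S powr \<epsilon> + leaves \<psi>\<^sub>2 * ?S powr \<epsilon> + z * ?S powr \<epsilon>"
      using \<eta>(2) \<eta>1(2) \<eta>2(2) by simp
    also have "\<dots> = ?S * ?S powr \<epsilon>" unfolding lS[symmetric] by (subst (3) lS) (simp add: algebra_simps)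
    finally have sz: "real (leaves ?\<phi>') \<le> ?S * ?S powr \<epsilon>" .
    have "B \<ge> 0" using \<eta>1(3) by linarith
    have "real (depth ?\<phi>') \<le> B + 3"
      using \<alpha>'(2) \<beta>'(2) \<eta>(3) by (cases \<alpha>'; cases \<beta>') (auto simp: and_opt_def or_opt_def; force)+
    thus ?thesis using eq sz by (auto simp: B_def)
  qed
qed

section \<open>Khrapchenko's bound with weights\<close>

text \<open>Cauchy-Schwarz for two terms; it combines the bounds for the two children of a
  gate.\<close>

lemma sqrt_add_sqrt_le:
  fixes a b c d :: real
  assumes "a \<ge> 0" "b \<ge> 0" "c \<ge> 0" "d \<ge> 0"
  shows "sqrt (a * b) + sqrt (c * d) \<le> sqrt ((a + c) * (b + d))"
proof (rule real_le_rsqrt)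
  have "0 \<le> (sqrt (a * d) - sqrt (c * b))\<^sup>2" by simp
  hence "2 * (sqrt (a * d) * sqrt (c * b)) \<le> a * d + c * b" using assms by (simp add: power2_diff)
  moreover have "sqrt (a * d) * sqrt (c * b) = sqrt (a * b) * sqrt (c * d)"
    by (simp add: real_sqrt_mult)
  ultimately show "(sqrt (a * b) + sqrt (c * d))\<^sup>2 \<le> (a + c) * (b + d)"
    using assms by (simp add: power2_sum algebra_simps)
qed

text \<open>Each point rejected by a conjunction is rejected by a child, which splits
  \<open>B\<close>; a disjunction splits \<open>A\<close> in the same way. If \<open>p\<close>
  indicates Hamming neighbours and \<open>U\<close>, \<open>V\<close> are constantly 1, this is
  Khrapchenko's classical bound.\<close>

lemma khrapchenko_aux:
  fixes p :: "'a \<Rightarrow> 'b \<Rightarrow> real"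
  assumes "finite A" "finite B" "\<And>a b. p a b \<ge> 0" "\<And>a. U a \<ge> 0" "\<And>b. V b \<ge> 0"
    and "\<And>v a. v \<in> vars \<phi> \<Longrightarrow> a \<in> A \<Longrightarrow> (\<Sum>b\<in>B. p a b * of_bool (x a v \<noteq> y b v)) \<le> U a"
    and "\<And>v b. v \<in> vars \<phi> \<Longrightarrow> b \<in> B \<Longrightarrow> (\<Sum>a\<in>A. p a b * of_bool (x a v \<noteq> y b v)) \<le> V b"
    and "\<And>a. a \<in> A \<Longrightarrow> eval_formula \<phi> (x a)" "\<And>b. b \<in> B \<Longrightarrow> \<not> eval_formula \<phi> (y b)"
  shows "(\<Sum>a\<in>A. \<Sum>b\<in>B. p a b) \<le> sqrt (real (leaves \<phi>) * sum U A * sum V B)"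
  using assms(1,2,6-)
proof (induction \<phi> arbitrary: A B)
  case (Lit v s)
  \<comment> \<open>A literal true on \<open>A\<close> and false on \<open>B\<close> differs on
    every pair, so the whole weight is at most \<open>sum U A\<close> and at most
    \<open>sum V B\<close>, hence at most their geometric mean.\<close>
  have d: "p a b = p a b * of_bool (x a v \<noteq> y b v)" if "a \<in> A" "b \<in> B" for a b
    using Lit.prems(5)[OF that(1)] Lit.prems(6)[OF that(2)] by auto
  have 1: "(\<Sum>a\<in>A. \<Sum>b\<in>B. p a b) \<le> sum U A"
  proof (rule sum_mono)
    fix a assume a: "a \<in> A"
    have "(\<Sum>b\<in>B. p a b) = (\<Sum>b\<in>B. p a b * of_bool (x a v \<noteq> y b v))"
      by (intro sum.cong refl d a)
    thus "(\<Sum>b\<in>B. p a b) \<le> U a" using Lit.prems(3)[of v a] a by simp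
  qed
  have 2: "(\<Sum>b\<in>B. \<Sum>a\<in>A. p a b) \<le> sum V B"
  proof (rule sum_mono)
    fix b assume b: "b \<in> B"
    have "(\<Sum>a\<in>A. p a b) = (\<Sum>a\<in>A. p a b * of_bool (x a v \<noteq> y b v))"
      by (intro sum.cong refl d b)
    thus "(\<Sum>a\<in>A. p a b) \<le> V b" using Lit.prems(4)[of v b] b by simp
  qed
  have "(\<Sum>a\<in>A. \<Sum>b\<in>B. p a b) * (\<Sum>a\<in>A. \<Sum>b\<in>B. p a b) \<le> sum U A * sum V B"
    using 1 2 assms(3,4,5) by (subst (2) sum.swap) (intro mult_mono sum_nonneg, auto)
  thus ?case by (intro real_le_rsqrt) (simp add: power2_eq_square)
next
  case (And \<phi> \<psi>)
  define B1 where "B1 = {b\<in>B. \<not> eval_formula \<phi> (y b)}"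
  define B2 where "B2 = B - B1"
  have fin: "finite B1" "finite B2" "B1 \<subseteq> B" "B2 \<subseteq> B" and un: "B = B1 \<union> B2" "B1 \<inter> B2 = {}"
    using And.prems(2) by (auto simp: B1_def B2_def)
  have mono: "(\<Sum>b\<in>B'. p a b * of_bool (x a v \<noteq> y b v)) \<le> U a"
    if "a \<in> A" "v \<in> vars (And \<phi> \<psi>)" "B' \<subseteq> B" for a v B'
    using And.prems(3)[OF that(2,1)] sum_mono2[OF And.prems(2) that(3), of "\<lambda>b. p a b * of_bool (x a v \<noteq> y b v)"] assms(3)
    by auto
  have 1: "(\<Sum>a\<in>A. \<Sum>b\<in>B1. p a b) \<le> sqrt (real (leaves \<phi>) * sum U A * sum V B1)"
    using And.prems fin mono[of _ _ B1] by (intro And.IH) (auto simp: B1_def)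
  have 2: "(\<Sum>a\<in>A. \<Sum>b\<in>B2. p a b) \<le> sqrt (real (leaves \<psi>) * sum U A * sum V B2)"
    using And.prems fin mono[of _ _ B2] by (intro And.IH) (auto simp: B1_def B2_def)
  have nn: "sum U A \<ge> 0" "sum V B1 \<ge> 0" "sum V B2 \<ge> 0" using assms by (auto intro!: sum_nonneg)
  have "(\<Sum>a\<in>A. \<Sum>b\<in>B. p a b) = (\<Sum>a\<in>A. \<Sum>b\<in>B1. p a b) + (\<Sum>a\<in>A. \<Sum>b\<in>B2. p a b)"
    unfolding un(1) sum.union_disjoint[OF fin(1,2) un(2)] by (simp add: sum.distrib)
  also have "\<dots> \<le> sqrt (real (leaves \<phi>) * (sum U A * sum V B1)) + sqrt (real (leaves \<psi>) * (sum U A * sum V B2))"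
    using 1 2 by (simp add: mult.assoc)
  also have "\<dots> \<le> sqrt ((real (leaves \<phi>) + real (leaves \<psi>)) * (sum U A * sum V B1 + sum U A * sum V B2))"
    using nn by (intro sqrt_add_sqrt_le) auto
  also have "\<dots> = sqrt (real (leaves (And \<phi> \<psi>)) * sum U A * sum V B)"
    unfolding un(1) sum.union_disjoint[OF fin(1,2) un(2)] by (simp add: algebra_simps)
  finally show ?case .
next
  case (Or \<phi> \<psi>)
  define A1 where "A1 = {a\<in>A. eval_formula \<phi> (x a)}"
  define A2 where "A2 = A - A1"
  have fin: "finite A1" "finite A2" "A1 \<subseteq> A" "A2 \<subseteq> A" and un: "A = A1 \<union> A2" "A1 \<inter> A2 = {}"
    using Or.prems(1) by (auto simp: A1_def A2_def)
  have mono: "(\<Sum>a\<in>A'. p a b * of_bool (x a v \<noteq> y b v)) \<le> V b"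
    if "b \<in> B" "v \<in> vars (Or \<phi> \<psi>)" "A' \<subseteq> A" for b v A'
    using Or.prems(4)[OF that(2,1)] sum_mono2[OF Or.prems(1) that(3), of "\<lambda>a. p a b * of_bool (x a v \<noteq> y b v)"] assms(3)
    by auto
  have 1: "(\<Sum>a\<in>A1. \<Sum>b\<in>B. p a b) \<le> sqrt (real (leaves \<phi>) * sum U A1 * sum V B)"
    using Or.prems fin mono[of _ _ A1] by (intro Or.IH) (auto simp: A1_def)
  have 2: "(\<Sum>a\<in>A2. \<Sum>b\<in>B. p a b) \<le> sqrt (real (leaves \<psi>) * sum U A2 * sum V B)"
  proof (intro Or.IH)
    show "eval_formula \<psi> (x a)" if "a \<in> A2" for a
      using Or.prems(5)[of a] that by (auto simp: A1_def A2_def)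
  qed (use Or.prems fin mono[of _ _ A2] in auto)
  have nn: "sum V B \<ge> 0" "sum U A1 \<ge> 0" "sum U A2 \<ge> 0" using assms by (auto intro!: sum_nonneg)
  have "(\<Sum>a\<in>A. \<Sum>b\<in>B. p a b) = (\<Sum>a\<in>A1. \<Sum>b\<in>B. p a b) + (\<Sum>a\<in>A2. \<Sum>b\<in>B. p a b)"
    unfolding un(1) sum.union_disjoint[OF fin(1,2) un(2)] by simp
  also have "\<dots> \<le> sqrt (real (leaves \<phi>) * (sum U A1 * sum V B)) + sqrt (real (leaves \<psi>) * (sum U A2 * sum V B))"
    using 1 2 by (simp add: mult.assoc)
  also have "\<dots> \<le> sqrt ((real (leaves \<phi>) + real (leaves \<psi>)) * (sum U A1 * sum V B + sum U A2 * sum V B))"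
    using nn by (intro sqrt_add_sqrt_le) auto
  also have "\<dots> = sqrt (real (leaves (Or \<phi> \<psi>)) * sum U A * sum V B)"
    unfolding un(1) sum.union_disjoint[OF fin(1,2) un(2)] by (simp add: algebra_simps)
  finally show ?case .
qed

text \<open>For false \<sigma> the two sides exchange roles, which avoids negating \<phi>.\<close>

lemma khrapchenko_bound:
  fixes p :: "'a \<Rightarrow> 'b \<Rightarrow> real"
  assumes fin: "finite A" "finite B" and nn: "\<And>a b. p a b \<ge> 0" "\<And>a. U a \<ge> 0" "\<And>b. V b \<ge> 0"
    and U: "\<And>v a. v \<in> vars \<phi> \<Longrightarrow> a \<in> A \<Longrightarrow> (\<Sum>b\<in>B. p a b * of_bool (x a v \<noteq> y b v)) \<le> U a"
    and V: "\<And>v b. v \<in> vars \<phi> \<Longrightarrow> b \<in> B \<Longrightarrow> (\<Sum>a\<in>A. p a b * of_bool (x a v \<noteq> y b v)) \<le> V b"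
    and ev: "\<And>a. a \<in> A \<Longrightarrow> eval_formula \<phi> (x a) = \<sigma>" "\<And>b. b \<in> B \<Longrightarrow> eval_formula \<phi> (y b) = (\<not> \<sigma>)"
  shows "(\<Sum>a\<in>A. \<Sum>b\<in>B. p a b) \<le> sqrt (real (leaves \<phi>) * sum U A * sum V B)"
proof (cases \<sigma>)
  case True
  show ?thesis by (rule khrapchenko_aux[of A B p U V \<phi> x y]) (use assms True in auto)
next
  case False
  have "(\<Sum>b\<in>B. \<Sum>a\<in>A. p a b) \<le> sqrt (real (leaves \<phi>) * sum V B * sum U A)"
  proof (rule khrapchenko_aux[of B A "\<lambda>b a. p a b" V U \<phi> y x])
    show "(\<Sum>a\<in>A. p a b * of_bool (y b v \<noteq> x a v)) \<le> V b" if "v \<in> vars \<phi>" "b \<in> B" for v b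
      using V[OF that] by (simp add: eq_commute[of "y b v"])
    show "(\<Sum>b\<in>B. p a b * of_bool (y b v \<noteq> x a v)) \<le> U a" if "v \<in> vars \<phi>" "a \<in> A" for v a
      using U[OF that] by (simp add: eq_commute[of _ "x a v"])
  qed (use fin nn ev False in auto)
  thus ?thesis by (subst sum.swap) (simp add: mult_ac)
qed

section \<open>Gates, gate weights and simple functions\<close>

text \<open>Conjunction is \<open>gate True\<close> and disjunction \<open>gate False\<close>: the gate has value \<open>\<tau>\<close> iff both inputs do,
  which lets dual arguments be given once.\<close>

definition gate :: "bool \<Rightarrow> 'v formula \<Rightarrow> 'v formula \<Rightarrow> 'v formula" where
  "gate \<tau> \<phi> \<psi> = (if \<tau> then And \<phi> \<psi> else Or \<phi> \<psi>)"

lemma gate_simps [simp]: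
  "vars (gate \<tau> \<phi> \<psi>) = vars \<phi> \<union> vars \<psi>"
  "leaves (gate \<tau> \<phi> \<psi>) = leaves \<phi> + leaves \<psi>"
  "depth (gate \<tau> \<phi> \<psi>) = Suc (max (depth \<phi>) (depth \<psi>))"
  "eval_formula (gate \<tau> \<phi> \<psi>) x =
     (if \<tau> then eval_formula \<phi> x \<and> eval_formula \<psi> x else eval_formula \<phi> x \<or> eval_formula \<psi> x)"
  by (auto simp: gate_def)

lemma formula_gate_induct [case_names Lit gate]:
  assumes "\<And>v s. P (Lit v s)" "\<And>\<tau> \<phi> \<psi>. P \<phi> \<Longrightarrow> P \<psi> \<Longrightarrow> P (gate \<tau> \<phi> \<psi>)"
  shows "P \<phi>"
proof (induction \<phi>)
  case (And \<phi> \<psi>)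
  thus ?case using assms(2)[of \<phi> \<psi> True] by (simp add: gate_def)
next
  case (Or \<phi> \<psi>)
  thus ?case using assms(2)[of \<phi> \<psi> False] by (simp add: gate_def)
qed (rule assms(1))

text \<open>Each gate contributes the product of the two square roots that govern the probabilities
  of its children; times powers of \<theta> and a depth factor, the sum bounds the expected number
  of hits.\<close>

primrec gate_weight :: "'v formula \<Rightarrow> real" where
  "gate_weight (Lit v s) = 0"
| "gate_weight (And \<phi> \<psi>) = gate_weight \<phi> + gate_weight \<psi> + sqrt (leaves \<phi>) * sqrt (leaves \<psi>)"
| "gate_weight (Or \<phi> \<psi>) = gate_weight \<phi> + gate_weight \<psi> + sqrt (leaves \<phi>) * sqrt (leaves \<psi>)"

lemma gate_weight_gate [simp]:
  "gate_weight (gate \<tau> \<phi> \<psi>) = gate_weight \<phi> + gate_weight \<psi> + sqrt (leaves \<phi>) * sqrt (leaves \<psi>)"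
  by (simp add: gate_def)

text \<open>By the inequality of arithmetic and geometric means a gate contributes at most its
  number of leaves, and a leaf lies below at most \<open>depth \<phi>\<close> gates.\<close>

lemma gate_weight_le: "gate_weight \<phi> \<le> real (depth \<phi>) * real (leaves \<phi>)"
proof (induction \<phi> rule: formula_gate_induct)
  case (gate \<tau> \<phi> \<psi>)
  let ?d = "real (max (depth \<phi>) (depth \<psi>))" and ?a = "real (leaves \<phi>)" and ?b = "real (leaves \<psi>)"
  have "gate_weight \<phi> \<le> ?d * ?a"
    by (rule order_trans[OF gate.IH(1)]) (simp add: mult_right_mono)
  moreover have "gate_weight \<psi> \<le> ?d * ?b"
    by (rule order_trans[OF gate.IH(2)]) (simp add: mult_right_mono)
  moreover have "sqrt ?a * sqrt ?b \<le> ?a + ?b"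
    using arith_geo_mean_sqrt[of ?a ?b] by (simp add: real_sqrt_mult)
  moreover have "real (Suc (max (depth \<phi>) (depth \<psi>))) = ?d + 1" by simp
  ultimately show ?case
    unfolding gate_simps gate_weight_gate by (simp only: of_nat_add) (simp add: algebra_simps)
qed simp

text \<open>Constants and literals are free of charge, so \<open>N = 0\<close> is a meaningful
  bound; it is the one obtained for a projection without hits.\<close>

definition simple_up_to :: "'i set \<Rightarrow> nat \<Rightarrow> (('i \<Rightarrow> bool) \<Rightarrow> bool) \<Rightarrow> bool" where
  "simple_up_to I N h \<longleftrightarrow> (\<exists>c. \<forall>y. h y = c) \<or> (\<exists>k\<in>I. \<exists>\<sigma>. \<forall>y. h y = (y k = \<sigma>)) \<or>
     (\<exists>\<phi>. vars \<phi> \<subseteq> I \<and> (\<forall>y. eval_formula \<phi> y = h y) \<and> leaves \<phi> \<le> N)"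

lemma simple_up_to_cases:
  assumes "simple_up_to I N h"
  obtains (const) c where "\<And>y. h y = c"
    | (literal) k \<sigma> where "k \<in> I" "\<And>y. h y = (y k = \<sigma>)"
    | (formula) \<phi> where "vars \<phi> \<subseteq> I" "\<And>y. eval_formula \<phi> y = h y" "leaves \<phi> \<le> N"
  using assms unfolding simple_up_to_def
proof (elim disjE exE bexE conjE)
  fix c assume "\<forall>y. h y = c"
  thus thesis by (intro const) simp
next
  fix k \<sigma> assume "k \<in> I" "\<forall>y. h y = (y k = \<sigma>)"
  thus thesis by (intro literal) simp_all
next
  fix \<phi> assume "vars \<phi> \<subseteq> I" "\<forall>y. eval_formula \<phi> y = h y" "leaves \<phi> \<le> N"
  thus thesis by (intro formula) simp_all
qed

lemma simple_up_to_mono: "simple_up_to I N h \<Longrightarrow> N \<le> N' \<Longrightarrow> simple_up_to I N' h"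
  unfolding simple_up_to_def
  by (elim disjE) (blast, blast, meson order_trans)

section \<open>Random block projections\<close>

text \<open>A projection sends each block \<open>i\<close> to a pair \<open>\<pi> i = (u, v)\<close>: the block reads \<open>u\<close> if \<open>y\<^sub>i = 0\<close> and \<open>v\<close> if
  \<open>y\<^sub>i = 1\<close>. A pair \<open>(u, u)\<close> is a block in which \<open>y\<^sub>i\<close> has already been fixed. The blocks are independent with
  distribution \<open>w\<close>. The two fixing conditions say that, compared with the outcome in which \<open>y\<^sub>i\<close> is fixed, it is
  unlikely that a given coordinate still depends on \<open>y\<^sub>i\<close>.\<close>

locale block_projection =
  fixes I :: "'i set" and J :: "'j set" and X :: "('j \<Rightarrow> bool) set"
    and w :: "('j \<Rightarrow> bool) \<times> ('j \<Rightarrow> bool) \<Rightarrow> real" and \<kappa>\<^sub>0 \<kappa>\<^sub>1 :: real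
  assumes finite_I: "finite I" and finite_X: "finite X"
    and w_nonneg: "w q \<ge> 0"
    and w_total: "(\<Sum>q\<in>X \<times> X. w q) = 1"
    and w_diag: "u \<in> X \<Longrightarrow> v \<in> X \<Longrightarrow> w (u, v) > 0 \<Longrightarrow> w (u, u) > 0 \<and> w (v, v) > 0"
    and \<kappa>_nonneg: "\<kappa>\<^sub>0 \<ge> 0" "\<kappa>\<^sub>1 \<ge> 0"
    and fixing0: "u \<in> X \<Longrightarrow> j \<in> J \<Longrightarrow> (\<Sum>v\<in>X. w (u, v) * of_bool (v j \<noteq> u j)) \<le> \<kappa>\<^sub>0 * w (u, u)"
    and fixing1: "v \<in> X \<Longrightarrow> j \<in> J \<Longrightarrow> (\<Sum>u\<in>X. w (u, v) * of_bool (v j \<noteq> u j)) \<le> \<kappa>\<^sub>1 * w (v, v)"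
begin

definition weight :: "'i set \<Rightarrow> ('i \<Rightarrow> ('j \<Rightarrow> bool) \<times> ('j \<Rightarrow> bool)) \<Rightarrow> real" where
  "weight K \<pi> = (\<Prod>i\<in>K. w (\<pi> i))"

definition expect :: "(('i \<Rightarrow> ('j \<Rightarrow> bool) \<times> ('j \<Rightarrow> bool)) \<Rightarrow> real) \<Rightarrow> real" where
  "expect F = (\<Sum>\<pi>\<in>I \<rightarrow>\<^sub>E X \<times> X. weight I \<pi> * F \<pi>)"

definition Pr :: "(('i \<Rightarrow> ('j \<Rightarrow> bool) \<times> ('j \<Rightarrow> bool)) \<Rightarrow> bool) \<Rightarrow> real" where
  "Pr P = expect (\<lambda>\<pi>. of_bool (P \<pi>))"

definition sel :: "bool \<Rightarrow> 'a \<times> 'a \<Rightarrow> 'a" where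
  "sel c q = (if c then snd q else fst q)"

definition proj :: "('i \<Rightarrow> ('j \<Rightarrow> bool) \<times> ('j \<Rightarrow> bool)) \<Rightarrow> ('i \<Rightarrow> bool) \<Rightarrow> 'i \<times> 'j \<Rightarrow> bool" where
  "proj \<pi> y = (\<lambda>(i, j). sel (y i) (\<pi> i) j)"

text \<open>A fixed block becomes a diagonal pair, so the outcome of fixing is again a projection
  and has its own weight.\<close>

definition fix_block :: "('i \<Rightarrow> 'a \<times> 'a) \<Rightarrow> 'i \<Rightarrow> bool \<Rightarrow> 'i \<Rightarrow> 'a \<times> 'a" where
  "fix_block \<pi> k c = \<pi>(k := (sel c (\<pi> k), sel c (\<pi> k)))"

text \<open>These are the events to condition on: with each outcome they contain the diagonal
  outcomes to which the fixing conditions compare it.\<close>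

definition closed_event :: "(('i \<Rightarrow> ('j \<Rightarrow> bool) \<times> ('j \<Rightarrow> bool)) \<Rightarrow> bool) \<Rightarrow> bool" where
  "closed_event \<Delta> \<longleftrightarrow> (\<forall>\<pi>. \<forall>k\<in>I. \<forall>c. \<Delta> \<pi> \<longrightarrow> \<Delta> (fix_block \<pi> k c))"

definition is_literal where
  "is_literal \<pi> \<psi> k \<sigma> \<longleftrightarrow> (\<forall>y. eval_formula \<psi> (proj \<pi> y) = (y k = \<sigma>))"

definition nonconst where
  "nonconst \<pi> \<psi> \<longleftrightarrow> \<not> (\<exists>c. \<forall>y. eval_formula \<psi> (proj \<pi> y) = c)"

lemma sel_simps [simp]: "sel True q = snd q" "sel False q = fst q" "sel c (u, u) = u"
  by (auto simp: sel_def)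

lemma proj_fix_block: "proj (fix_block \<pi> k c) y = proj \<pi> (y(k := c))"
  by (auto simp: proj_def fix_block_def fun_eq_iff)

lemma weight_nonneg: "weight K \<pi> \<ge> 0"
  unfolding weight_def by (intro prod_nonneg) (auto simp: w_nonneg)

lemma expect_mono: "(\<And>\<pi>. \<pi> \<in> I \<rightarrow>\<^sub>E X \<times> X \<Longrightarrow> F \<pi> \<le> G \<pi>) \<Longrightarrow> expect F \<le> expect G"
  unfolding expect_def by (intro sum_mono mult_left_mono weight_nonneg)

lemma expect_add: "expect (\<lambda>\<pi>. F \<pi> + G \<pi>) = expect F + expect G"
  unfolding expect_def by (simp add: sum.distrib algebra_simps)

lemma Pr_nonneg: "Pr P \<ge> 0"
  unfolding Pr_def expect_def by (intro sum_nonneg mult_nonneg_nonneg weight_nonneg) auto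

lemma Pr_mono: "(\<And>\<pi>. \<pi> \<in> I \<rightarrow>\<^sub>E X \<times> X \<Longrightarrow> P \<pi> \<Longrightarrow> Q \<pi>) \<Longrightarrow> Pr P \<le> Pr Q"
  unfolding Pr_def by (intro expect_mono) auto

lemma Pr_disj: "Pr (\<lambda>\<pi>. P \<pi> \<or> Q \<pi>) \<le> Pr P + Pr Q"
  unfolding Pr_def expect_add[symmetric] by (intro expect_mono) auto

lemma Pr_Bex_le: "finite S \<Longrightarrow> Pr (\<lambda>\<pi>. \<exists>s\<in>S. P s \<pi>) \<le> (\<Sum>s\<in>S. Pr (P s))"
proof (induction S rule: finite_induct)
  case empty
  then show ?case by (simp add: Pr_def expect_def)
next
  case (insert s S)
  have "Pr (\<lambda>\<pi>. \<exists>s\<in>insert s S. P s \<pi>) \<le> Pr (P s) + Pr (\<lambda>\<pi>. \<exists>s\<in>S. P s \<pi>)"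
    using Pr_disj[of "P s" "\<lambda>\<pi>. \<exists>s\<in>S. P s \<pi>"] by simp
  thus ?case using insert by simp
qed

lemma Pr_True: "Pr (\<lambda>_. True) = 1"
  unfolding Pr_def expect_def weight_def
  using prod_sum_PiE[of I "\<lambda>_. X \<times> X" "\<lambda>_. w"] finite_I finite_X by (simp add: w_total)

text \<open>Independence: block \<open>k\<close> is drawn apart from all other blocks.\<close>

lemma expect_split:
  assumes "k \<in> I"
  shows "expect F = (\<Sum>q\<in>X \<times> X. w q * (\<Sum>\<pi>\<in>I - {k} \<rightarrow>\<^sub>E X \<times> X. weight (I - {k}) \<pi> * F (\<pi>(k := q))))"
proof -
  have I: "I = insert k (I - {k})" using assms by auto
  have inj: "inj_on (\<lambda>(y, g). g(k := y)) ((X \<times> X) \<times> (I - {k} \<rightarrow>\<^sub>E X \<times> X))"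
    using inj_combinator[of k "I - {k}" "\<lambda>_. X \<times> X"] by simp
  have wt: "weight I (\<pi>(k := q)) = w q * weight (I - {k}) \<pi>" for \<pi> q
    unfolding weight_def by (subst prod.remove[OF finite_I assms]) (auto intro!: prod.cong)
  have img: "I \<rightarrow>\<^sub>E X \<times> X = (\<lambda>(y, g). g(k := y)) ` ((X \<times> X) \<times> (I - {k} \<rightarrow>\<^sub>E X \<times> X))"
    by (subst I) (rule PiE_insert_eq)
  have "expect F = (\<Sum>(q, \<pi>)\<in>(X \<times> X) \<times> (I - {k} \<rightarrow>\<^sub>E X \<times> X). weight I (\<pi>(k := q)) * F (\<pi>(k := q)))"
    unfolding expect_def img sum.reindex[OF inj] by (simp add: o_def case_prod_unfold)
  also have "\<dots> = (\<Sum>q\<in>X \<times> X. \<Sum>\<pi>\<in>I - {k} \<rightarrow>\<^sub>E X \<times> X. weight I (\<pi>(k := q)) * F (\<pi>(k := q)))"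
    by (rule sum.cartesian_product[symmetric])
  finally show ?thesis by (simp add: wt sum_distrib_left mult.assoc)
qed

lemma expect_split':
  assumes "k \<in> I"
  shows "expect F = (\<Sum>\<pi>\<in>I - {k} \<rightarrow>\<^sub>E X \<times> X. weight (I - {k}) \<pi> * (\<Sum>q\<in>X \<times> X. w q * F (\<pi>(k := q))))"
  unfolding expect_split[OF assms] sum_distrib_left by (subst sum.swap) (simp add: mult_ac)

lemma Pr_block_eq:
  assumes "k \<in> I" "r \<in> X \<times> X"
  shows "Pr (\<lambda>\<pi>. \<pi> k = r \<and> R \<pi>) =
    w r * (\<Sum>\<pi>\<in>I - {k} \<rightarrow>\<^sub>E X \<times> X. weight (I - {k}) \<pi> * of_bool (R (\<pi>(k := r))))"
proof -
  have "Pr (\<lambda>\<pi>. \<pi> k = r \<and> R \<pi>) = (\<Sum>q\<in>X \<times> X. if q = r then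
     w r * (\<Sum>\<pi>\<in>I - {k} \<rightarrow>\<^sub>E X \<times> X. weight (I - {k}) \<pi> * of_bool (R (\<pi>(k := r)))) else 0)"
    unfolding Pr_def expect_split[OF assms(1)] by (intro sum.cong refl) auto
  also have "\<dots> = w r * (\<Sum>\<pi>\<in>I - {k} \<rightarrow>\<^sub>E X \<times> X. weight (I - {k}) \<pi> * of_bool (R (\<pi>(k := r))))"
    using assms(2) finite_X by (subst sum.delta) auto
  finally show ?thesis .
qed

text \<open>All other blocks are frozen. A pair that makes \<psi> a literal joins a point of
  \<open>B\<close> to a point of \<open>A\<close>, and closedness puts both diagonal pairs into
  \<Delta>. Khrapchenko's bound, with the fixing conditions as \<open>U\<close> and
  \<open>V\<close>, compares the weight of such pairs with the diagonal weights; the 1/2 comes from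
  the arithmetic-geometric mean.\<close>

lemma literal_block_bound:
  assumes \<Delta>: "closed_event \<Delta>" and k: "k \<in> I" and vars: "vars \<psi> \<subseteq> I \<times> J"
  shows "(\<Sum>q\<in>X \<times> X. w q * of_bool (\<Delta> (\<pi>(k := q)) \<and> is_literal (\<pi>(k := q)) \<psi> k \<sigma>))
     \<le> sqrt (\<kappa>\<^sub>0 * \<kappa>\<^sub>1) * sqrt (leaves \<psi>) / 2 * (\<Sum>q\<in>X \<times> X. w q * of_bool (\<Delta> (\<pi>(k := q))))"
proof -
  \<comment> \<open>The other variables are set to false; a literal of \<open>y\<^sub>k\<close>
    ignores them.\<close>
  define x where "x v = proj (\<pi>(k := (v, v))) (\<lambda>_. False)" for v
  define A where "A = {v\<in>X. \<Delta> (\<pi>(k := (v, v))) \<and> eval_formula \<psi> (x v) = \<sigma>}"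
  define B where "B = {u\<in>X. \<Delta> (\<pi>(k := (u, u))) \<and> eval_formula \<psi> (x u) = (\<not> \<sigma>)}"
  have fin: "finite A" "finite B" "A \<subseteq> X" "B \<subseteq> X" using finite_X by (auto simp: A_def B_def)
  have in_AB: "v \<in> A" "u \<in> B"
    if "u \<in> X" "v \<in> X" "\<Delta> (\<pi>(k := (u, v)))" "is_literal (\<pi>(k := (u, v))) \<psi> k \<sigma>" for u v
  proof -
    have f: "fix_block (\<pi>(k := (u, v))) k c = \<pi>(k := (if c then v else u, if c then v else u))" for c
      by (simp add: fix_block_def sel_def)
    have "\<Delta> (\<pi>(k := (if c then v else u, if c then v else u)))" for c
      using \<Delta> that(3) k unfolding closed_event_def f[symmetric] by blast
    from this[of True] this[of False] have 1: "\<Delta> (\<pi>(k := (v, v)))" "\<Delta> (\<pi>(k := (u, u)))" by simp_all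
    have x: "x (if c then v else u) = proj (\<pi>(k := (u, v))) ((\<lambda>_. False)(k := c))" for c
      unfolding x_def f[symmetric] proj_fix_block by simp
    have "eval_formula \<psi> (x (if c then v else u)) = (c = \<sigma>)" for c
      unfolding x using that(4) by (simp add: is_literal_def)
    from this[of True] this[of False] show "v \<in> A" "u \<in> B" using that 1 by (auto simp: A_def B_def)
  qed
  have x_diff: "(x v (i, j) \<noteq> x u (i, j)) = (i = k \<and> v j \<noteq> u j)" for u v i j
    by (auto simp: x_def proj_def sel_def)
  \<comment> \<open>\<psi> takes opposite values on \<open>A\<close> and \<open>B\<close>, so their
    diagonals are disjoint parts of \<Delta>.\<close>
  have "(\<Sum>v\<in>A. w (v, v)) + (\<Sum>u\<in>B. w (u, u)) = (\<Sum>v\<in>A \<union> B. w (v, v))"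
    using fin by (subst sum.union_disjoint) (auto simp: A_def B_def)
  also have "\<dots> = (\<Sum>q\<in>(\<lambda>v. (v, v)) ` (A \<union> B). w q)"
    by (subst sum.reindex) (auto simp: inj_on_def)
  also have "\<dots> = (\<Sum>q\<in>(\<lambda>v. (v, v)) ` (A \<union> B). w q * of_bool (\<Delta> (\<pi>(k := q))))"
    by (intro sum.cong) (auto simp: A_def B_def)
  also have "\<dots> \<le> (\<Sum>q\<in>X \<times> X. w q * of_bool (\<Delta> (\<pi>(k := q))))"
    using fin finite_X w_nonneg by (intro sum_mono2) auto
  finally have diag: "(\<Sum>v\<in>A. w (v, v)) + (\<Sum>u\<in>B. w (u, u)) \<le> (\<Sum>q\<in>X \<times> X. w q * of_bool (\<Delta> (\<pi>(k := q))))" .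
  have "(\<Sum>q\<in>X \<times> X. w q * of_bool (\<Delta> (\<pi>(k := q)) \<and> is_literal (\<pi>(k := q)) \<psi> k \<sigma>))
     \<le> (\<Sum>q\<in>X \<times> X. w q * of_bool (q \<in> B \<times> A))"
    by (intro sum_mono mult_left_mono w_nonneg) (auto dest: in_AB)
  also have "\<dots> = (\<Sum>q\<in>B \<times> A. w q)"
    using fin finite_X by (intro sum.mono_neutral_cong_right) auto
  also have "\<dots> = (\<Sum>v\<in>A. \<Sum>u\<in>B. w (u, v))"
    by (subst sum.swap) (simp add: sum.cartesian_product)
  also have "\<dots> \<le> sqrt (real (leaves \<psi>) * (\<Sum>v\<in>A. \<kappa>\<^sub>1 * w (v, v)) * (\<Sum>u\<in>B. \<kappa>\<^sub>0 * w (u, u)))"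
  proof (rule khrapchenko_bound[where x = x and y = x and \<sigma> = \<sigma>])
    fix p v assume p: "p \<in> vars \<psi>" "v \<in> A"
    obtain i j where ij: "p = (i, j)" "j \<in> J" using vars p by auto
    have "(\<Sum>u\<in>B. w (u, v) * of_bool (x v p \<noteq> x u p)) \<le> (\<Sum>u\<in>X. w (u, v) * of_bool (v j \<noteq> u j))"
      unfolding ij x_diff using fin finite_X w_nonneg
      by (intro order_trans[OF sum_mono sum_mono2[of X B]]) auto
    also have "\<dots> \<le> \<kappa>\<^sub>1 * w (v, v)" using fin p ij by (intro fixing1) auto
    finally show "(\<Sum>u\<in>B. w (u, v) * of_bool (x v p \<noteq> x u p)) \<le> \<kappa>\<^sub>1 * w (v, v)" .
  next
    fix p u assume p: "p \<in> vars \<psi>" "u \<in> B"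
    obtain i j where ij: "p = (i, j)" "j \<in> J" using vars p by auto
    have "(\<Sum>v\<in>A. w (u, v) * of_bool (x v p \<noteq> x u p)) \<le> (\<Sum>v\<in>X. w (u, v) * of_bool (v j \<noteq> u j))"
      unfolding ij x_diff using fin finite_X w_nonneg
      by (intro order_trans[OF sum_mono sum_mono2[of X A]]) auto
    also have "\<dots> \<le> \<kappa>\<^sub>0 * w (u, u)" using fin p ij by (intro fixing0) auto
    finally show "(\<Sum>v\<in>A. w (u, v) * of_bool (x v p \<noteq> x u p)) \<le> \<kappa>\<^sub>0 * w (u, u)" .
  qed (use fin w_nonneg \<kappa>_nonneg in \<open>auto simp: A_def B_def\<close>)
  also have "\<dots> = sqrt (\<kappa>\<^sub>0 * \<kappa>\<^sub>1) * sqrt (leaves \<psi>) * sqrt ((\<Sum>v\<in>A. w (v, v)) * (\<Sum>u\<in>B. w (u, u)))"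
    by (simp add: sum_distrib_left[symmetric] real_sqrt_mult mult_ac)
  also have "\<dots> \<le> sqrt (\<kappa>\<^sub>0 * \<kappa>\<^sub>1) * sqrt (leaves \<psi>) * (((\<Sum>v\<in>A. w (v, v)) + (\<Sum>u\<in>B. w (u, u))) / 2)"
    using \<kappa>_nonneg w_nonneg by (intro mult_left_mono arith_geo_mean_sqrt sum_nonneg) auto
  also have "\<dots> \<le> sqrt (\<kappa>\<^sub>0 * \<kappa>\<^sub>1) * sqrt (leaves \<psi>) * ((\<Sum>q\<in>X \<times> X. w q * of_bool (\<Delta> (\<pi>(k := q)))) / 2)"
    using diag \<kappa>_nonneg by (intro mult_left_mono divide_right_mono) auto
  finally show ?thesis by simp
qed

lemma Pr_literal_le:
  assumes "closed_event \<Delta>" "k \<in> I" "vars \<psi> \<subseteq> I \<times> J"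
  shows "Pr (\<lambda>\<pi>. \<Delta> \<pi> \<and> is_literal \<pi> \<psi> k \<sigma>) \<le> sqrt (\<kappa>\<^sub>0 * \<kappa>\<^sub>1) * sqrt (leaves \<psi>) / 2 * Pr \<Delta>"
proof -
  have "Pr (\<lambda>\<pi>. \<Delta> \<pi> \<and> is_literal \<pi> \<psi> k \<sigma>) \<le> (\<Sum>\<pi>\<in>I - {k} \<rightarrow>\<^sub>E X \<times> X. weight (I - {k}) \<pi> *
     (sqrt (\<kappa>\<^sub>0 * \<kappa>\<^sub>1) * sqrt (leaves \<psi>) / 2 * (\<Sum>q\<in>X \<times> X. w q * of_bool (\<Delta> (\<pi>(k := q))))))"
    unfolding Pr_def expect_split'[OF assms(2)]
    by (intro sum_mono mult_left_mono weight_nonneg literal_block_bound assms)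
  also have "\<dots> = sqrt (\<kappa>\<^sub>0 * \<kappa>\<^sub>1) * sqrt (leaves \<psi>) / 2 * Pr \<Delta>"
    unfolding Pr_def expect_split'[OF assms(2)] by (simp add: sum_distrib_left mult_ac)
  finally show ?thesis .
qed

text \<open>Given the data of block \<open>k\<close>, the event that \<open>\<psi>\<close> becomes a literal of \<open>y\<^sub>k\<close> is closed in the other blocks,
  so a bound that holds relative to all closed events survives conditioning on it.\<close>

lemma Pr_literal_and_le:
  assumes \<Delta>: "closed_event \<Delta>" and k: "k \<in> I"
    and P: "\<And>\<Delta>. closed_event \<Delta> \<Longrightarrow> Pr (\<lambda>\<pi>. \<Delta> \<pi> \<and> P \<pi>) \<le> \<beta> * Pr \<Delta>"
  shows "Pr (\<lambda>\<pi>. \<Delta> \<pi> \<and> is_literal \<pi> \<psi> k \<sigma> \<and> P (fix_block \<pi> k c)) \<le> \<beta> * Pr (\<lambda>\<pi>. \<Delta> \<pi> \<and> is_literal \<pi> \<psi> k \<sigma>)"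
proof -
  let ?\<Pi> = "I - {k} \<rightarrow>\<^sub>E X \<times> X" and ?W = "weight (I - {k})"
  let ?R = "\<lambda>q \<pi>. \<Delta> (\<pi>(k := q)) \<and> is_literal (\<pi>(k := q)) \<psi> k \<sigma>"
  have block: "w q * (\<Sum>\<pi>\<in>?\<Pi>. ?W \<pi> * of_bool (?R q \<pi> \<and> P (fix_block (\<pi>(k := q)) k c)))
     \<le> w q * (\<beta> * (\<Sum>\<pi>\<in>?\<Pi>. ?W \<pi> * of_bool (?R q \<pi>)))" if q: "q \<in> X \<times> X" for q
  proof (cases "w q = 0")
    case False
    define u where "u = sel c q"
    have u: "(u, u) \<in> X \<times> X" using q by (auto simp: u_def sel_def)
    have wu: "w (u, u) > 0" using False w_nonneg[of q] w_diag[of "fst q" "snd q"] q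
      by (auto simp: u_def sel_def less_le)
    \<comment> \<open>Block \<open>k\<close> holds the fixed value, while \<Delta> and the literal
      condition are tested with the original pair \<open>q\<close> put back. The factor
      \<open>w (u, u)\<close> that this introduces is positive by \<open>w_diag\<close> and
      cancels.\<close>
    have "closed_event (\<lambda>\<pi>. \<pi> k = (u, u) \<and> ?R q \<pi>)"
      unfolding closed_event_def
    proof (intro allI ballI impI)
      fix \<pi> i c' assume i: "i \<in> I" and *: "\<pi> k = (u, u) \<and> ?R q \<pi>"
      show "fix_block \<pi> i c' k = (u, u) \<and> ?R q (fix_block \<pi> i c')"
      proof (cases "i = k")
        case True
        thus ?thesis using * by (simp add: fix_block_def)
      next
        case False
        have f: "(fix_block \<pi> i c')(k := q) = fix_block (\<pi>(k := q)) i c'"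
          using False by (auto simp: fix_block_def)
        have "\<Delta> (fix_block (\<pi>(k := q)) i c')" using \<Delta> * i by (simp add: closed_event_def)
        thus ?thesis unfolding f using * False
          by (simp add: is_literal_def proj_fix_block) (simp add: fix_block_def)
      qed
    qed
    from P[OF this] have "Pr (\<lambda>\<pi>. \<pi> k = (u, u) \<and> (?R q \<pi> \<and> P \<pi>)) \<le> \<beta> * Pr (\<lambda>\<pi>. \<pi> k = (u, u) \<and> ?R q \<pi>)"
      by (simp add: conj_assoc)
    hence "w (u, u) * (\<Sum>\<pi>\<in>?\<Pi>. ?W \<pi> * of_bool (?R q \<pi> \<and> P (\<pi>(k := (u, u)))))
      \<le> w (u, u) * (\<beta> * (\<Sum>\<pi>\<in>?\<Pi>. ?W \<pi> * of_bool (?R q \<pi>)))"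
      unfolding Pr_block_eq[OF k u] fun_upd_upd by (simp only: mult_ac)
    hence "(\<Sum>\<pi>\<in>?\<Pi>. ?W \<pi> * of_bool (?R q \<pi> \<and> P (\<pi>(k := (u, u)))))
      \<le> \<beta> * (\<Sum>\<pi>\<in>?\<Pi>. ?W \<pi> * of_bool (?R q \<pi>))"
      using wu by simp
    moreover have "fix_block (\<pi>(k := q)) k c = \<pi>(k := (u, u))" for \<pi>
      by (simp add: fix_block_def u_def)
    ultimately show ?thesis using w_nonneg by (simp add: mult_left_mono)
  qed simp
  have "Pr (\<lambda>\<pi>. \<Delta> \<pi> \<and> is_literal \<pi> \<psi> k \<sigma> \<and> P (fix_block \<pi> k c)) =
     (\<Sum>q\<in>X \<times> X. w q * (\<Sum>\<pi>\<in>?\<Pi>. ?W \<pi> * of_bool (?R q \<pi> \<and> P (fix_block (\<pi>(k := q)) k c))))"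
    unfolding Pr_def expect_split[OF k] by (simp add: conj_assoc)
  also have "\<dots> \<le> (\<Sum>q\<in>X \<times> X. w q * (\<beta> * (\<Sum>\<pi>\<in>?\<Pi>. ?W \<pi> * of_bool (?R q \<pi>))))"
    by (intro sum_mono block)
  also have "\<dots> = \<beta> * Pr (\<lambda>\<pi>. \<Delta> \<pi> \<and> is_literal \<pi> \<psi> k \<sigma>)"
    unfolding Pr_def expect_split[OF k] by (simp add: sum_distrib_left mult_ac)
  finally show ?thesis .
qed

text \<open>There are \<open>2 * card I\<close> literals, each reached with probability at most
  \<open>sqrt (\<kappa>\<^sub>0 * \<kappa>\<^sub>1) / 2\<close> times the square root of the number
  of leaves.\<close>

definition \<theta> :: real where
  "\<theta> = card I * sqrt (\<kappa>\<^sub>0 * \<kappa>\<^sub>1)"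

lemma \<theta>_nonneg: "\<theta> \<ge> 0"
  using \<kappa>_nonneg by (simp add: \<theta>_def)

text \<open>Union bound over \<open>k\<close> and \<sigma>. Setting \<open>y\<^sub>k\<close> to
  \<open>\<sigma> = \<tau>\<close> gives the literal the value \<tau>, under which a gate of type
  \<tau> copies its other input.\<close>

lemma Pr_some_literal_and_le:
  assumes \<Delta>: "closed_event \<Delta>" and vars: "vars \<psi> \<subseteq> I \<times> J" and \<beta>: "\<beta> \<ge> 0"
    and P: "\<And>\<Delta>. closed_event \<Delta> \<Longrightarrow> Pr (\<lambda>\<pi>. \<Delta> \<pi> \<and> P \<pi>) \<le> \<beta> * Pr \<Delta>"
  shows "Pr (\<lambda>\<pi>. \<Delta> \<pi> \<and> (\<exists>k\<in>I. \<exists>\<sigma>. is_literal \<pi> \<psi> k \<sigma> \<and> P (fix_block \<pi> k (\<sigma> = \<tau>))))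
    \<le> \<beta> * (\<theta> * sqrt (leaves \<psi>)) * Pr \<Delta>"
proof -
  let ?Q = "\<lambda>(k, \<sigma>) \<pi>. \<Delta> \<pi> \<and> is_literal \<pi> \<psi> k \<sigma> \<and> P (fix_block \<pi> k (\<sigma> = \<tau>))"
  let ?b = "sqrt (\<kappa>\<^sub>0 * \<kappa>\<^sub>1) * sqrt (leaves \<psi>) / 2 * Pr \<Delta>"
  have "Pr (\<lambda>\<pi>. \<Delta> \<pi> \<and> (\<exists>k\<in>I. \<exists>\<sigma>. is_literal \<pi> \<psi> k \<sigma> \<and> P (fix_block \<pi> k (\<sigma> = \<tau>))))
    \<le> Pr (\<lambda>\<pi>. \<exists>s\<in>I \<times> UNIV. ?Q s \<pi>)"
    by (intro Pr_mono) auto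
  also have "\<dots> \<le> (\<Sum>s\<in>I \<times> UNIV. Pr (?Q s))"
    using finite_I by (intro Pr_Bex_le) auto
  also have "\<dots> \<le> (\<Sum>s\<in>I \<times> (UNIV :: bool set). \<beta> * ?b)"
  proof (rule sum_mono)
    fix s :: "'i \<times> bool" assume "s \<in> I \<times> UNIV"
    then obtain k \<sigma> where s: "s = (k, \<sigma>)" "k \<in> I" by auto
    have "Pr (?Q s) \<le> \<beta> * Pr (\<lambda>\<pi>. \<Delta> \<pi> \<and> is_literal \<pi> \<psi> k \<sigma>)"
      unfolding s using Pr_literal_and_le[OF \<Delta> s(2) P] by simp
    also have "\<dots> \<le> \<beta> * ?b"
      by (intro mult_left_mono Pr_literal_le \<Delta> s vars \<beta>)
    finally show "Pr (?Q s) \<le> \<beta> * ?b" .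
  qed
  also have "\<dots> = \<beta> * (\<theta> * sqrt (leaves \<psi>)) * Pr \<Delta>"
    by (simp add: card_cartesian_product \<theta>_def)
  finally show ?thesis .
qed

definition some_literal where
  "some_literal \<pi> \<psi> \<longleftrightarrow> (\<exists>k\<in>I. \<exists>\<sigma>. is_literal \<pi> \<psi> k \<sigma>)"

lemma Pr_some_literal_le:
  assumes "closed_event \<Delta>" "vars \<psi> \<subseteq> I \<times> J"
  shows "Pr (\<lambda>\<pi>. \<Delta> \<pi> \<and> some_literal \<pi> \<psi>) \<le> \<theta> * sqrt (leaves \<psi>) * Pr \<Delta>"
  using Pr_some_literal_and_le[OF assms, of 1 "\<lambda>_. True"] by (simp add: some_literal_def)

lemma is_literal_fix_block: "is_literal \<pi> \<psi> k \<sigma> \<Longrightarrow> i \<noteq> k \<Longrightarrow> is_literal (fix_block \<pi> i c) \<psi> k \<sigma>"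
  by (simp add: is_literal_def proj_fix_block)

text \<open>A constant child makes the gate constant or equal to the other child, and two literals
  of one variable give a literal or a constant. If no child is complex, two literals of different
  variables remain, and fixing the first variable leaves the second child a literal.\<close>

lemma gate_complex_cases:
  assumes "nonconst \<pi> (gate \<tau> \<phi> \<psi>)" "\<not> some_literal \<pi> (gate \<tau> \<phi> \<psi>)"
  shows "nonconst \<pi> \<phi> \<and> \<not> some_literal \<pi> \<phi> \<or> nonconst \<pi> \<psi> \<and> \<not> some_literal \<pi> \<psi> \<or>
    (\<exists>k\<in>I. \<exists>\<sigma>. is_literal \<pi> \<phi> k \<sigma> \<and> some_literal (fix_block \<pi> k (\<sigma> = \<tau>)) \<psi>)"
proof (rule ccontr)
  assume neg: "\<not> ?thesis"
  have eq1: "eval_formula (gate \<tau> \<phi> \<psi>) x = (if c = \<tau> then eval_formula \<psi> x else c)" if "eval_formula \<phi> x = c" for x c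
    using that by auto
  have eq2: "eval_formula (gate \<tau> \<phi> \<psi>) x = (if c = \<tau> then eval_formula \<phi> x else c)" if "eval_formula \<psi> x = c" for x c
    using that by auto
  have c1: "nonconst \<pi> \<phi>"
  proof (rule ccontr)
    assume "\<not> nonconst \<pi> \<phi>"
    then obtain c where c: "\<And>y. eval_formula \<phi> (proj \<pi> y) = c" by (auto simp: nonconst_def)
    show False using eq1[OF c] assms neg
      by (cases "c = \<tau>") (auto simp: nonconst_def some_literal_def is_literal_def)
  qed
  have c2: "nonconst \<pi> \<psi>"
  proof (rule ccontr)
    assume "\<not> nonconst \<pi> \<psi>"
    then obtain c where c: "\<And>y. eval_formula \<psi> (proj \<pi> y) = c" by (auto simp: nonconst_def)
    show False using eq2[OF c] assms neg
      by (cases "c = \<tau>") (auto simp: nonconst_def some_literal_def is_literal_def)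
  qed
  obtain k \<sigma> where k: "k \<in> I" "is_literal \<pi> \<phi> k \<sigma>" using c1 neg by (auto simp: some_literal_def)
  obtain k' \<sigma>' where k': "k' \<in> I" "is_literal \<pi> \<psi> k' \<sigma>'" using c2 neg by (auto simp: some_literal_def)
  have "k = k'"
  proof (rule ccontr)
    assume "k \<noteq> k'"
    hence "some_literal (fix_block \<pi> k (\<sigma> = \<tau>)) \<psi>"
      using is_literal_fix_block[OF k'(2), of k] k'(1) unfolding some_literal_def by blast
    thus False using neg k by blast
  qed
  hence e: "eval_formula (gate \<tau> \<phi> \<psi>) (proj \<pi> y) = (if \<sigma> = \<sigma>' then y k = \<sigma> else \<not> \<tau>)" for y
    using k(2) k'(2) by (auto simp: is_literal_def)
  show False
  proof (cases "\<sigma> = \<sigma>'")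
    case True
    thus ?thesis using assms(2) e k(1) by (auto simp: some_literal_def is_literal_def)
  next
    case False
    thus ?thesis using assms(1) e by (auto simp: nonconst_def)
  qed
qed

text \<open>A leaf is never complex, so the descent through complex children ends at a gate of the
  third kind in \<open>gate_complex_cases\<close>. There the two literal probabilities multiply, and
  a union bound over the gates sums the products to \<open>gate_weight\<close>.\<close>

lemma Pr_complex_le:
  assumes "closed_event \<Delta>" "vars \<psi> \<subseteq> I \<times> J"
  shows "Pr (\<lambda>\<pi>. \<Delta> \<pi> \<and> nonconst \<pi> \<psi> \<and> \<not> some_literal \<pi> \<psi>) \<le> \<theta>\<^sup>2 * gate_weight \<psi> * Pr \<Delta>"
  using assms(2)
proof (induction \<psi> rule: formula_gate_induct)
  case (Lit p s)
  obtain i j where p: "p = (i, j)" by (cases p)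
  have False if "nonconst \<pi> (Lit p s)" "\<not> some_literal \<pi> (Lit p s)" for \<pi>
  proof (cases "fst (\<pi> i) j = snd (\<pi> i) j")
    case True
    hence "eval_formula (Lit p s) (proj \<pi> y) = (snd (\<pi> i) j = s)" for y by (simp add: p proj_def sel_def)
    thus ?thesis using that(1) unfolding nonconst_def by blast
  next
    case False
    hence "is_literal \<pi> (Lit p s) i (snd (\<pi> i) j = s)" by (auto simp: is_literal_def p proj_def sel_def)
    thus ?thesis using that(2) Lit p by (auto simp: some_literal_def)
  qed
  hence "Pr (\<lambda>\<pi>. \<Delta> \<pi> \<and> nonconst \<pi> (Lit p s) \<and> \<not> some_literal \<pi> (Lit p s)) \<le> Pr (\<lambda>_. False)"
    by (intro Pr_mono) auto
  also have "\<dots> = 0" by (simp add: Pr_def expect_def)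
  finally show ?case by simp
next
  case (gate \<tau> \<phi> \<psi>)
  let ?h = "\<lambda>\<pi>. \<exists>k\<in>I. \<exists>\<sigma>. is_literal \<pi> \<phi> k \<sigma> \<and> some_literal (fix_block \<pi> k (\<sigma> = \<tau>)) \<psi>"
  let ?c = "\<lambda>\<psi> \<pi>. \<Delta> \<pi> \<and> nonconst \<pi> \<psi> \<and> \<not> some_literal \<pi> \<psi>"
  have "Pr (?c (gate \<tau> \<phi> \<psi>)) \<le> Pr (\<lambda>\<pi>. ?c \<phi> \<pi> \<or> (?c \<psi> \<pi> \<or> \<Delta> \<pi> \<and> ?h \<pi>))"
    using gate_complex_cases by (intro Pr_mono) blast
  also have "\<dots> \<le> Pr (?c \<phi>) + (Pr (?c \<psi>) + Pr (\<lambda>\<pi>. \<Delta> \<pi> \<and> ?h \<pi>))"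
    by (intro order_trans[OF Pr_disj] add_left_mono Pr_disj)
  also have "Pr (\<lambda>\<pi>. \<Delta> \<pi> \<and> ?h \<pi>) \<le> (\<theta> * sqrt (leaves \<psi>)) * (\<theta> * sqrt (leaves \<phi>)) * Pr \<Delta>"
    using gate.prems \<theta>_nonneg by (intro Pr_some_literal_and_le assms Pr_some_literal_le) auto
  finally show ?case using gate by (simp add: algebra_simps power2_eq_square)
qed

text \<open>Nonconstant means literal or complex. With
  \<open>t = \<theta> * sqrt (leaves \<psi>)\<close> the complex part is at most
  \<open>d * t\<^sup>2\<close>, hence at most \<open>d * t\<close> when \<open>t < 1\<close>; for
  \<open>t \<ge> 1\<close> the claim is trivial.\<close>

lemma Pr_nonconst_le:
  assumes "closed_event \<Delta>" "vars \<psi> \<subseteq> I \<times> J" "depth \<psi> \<le> d"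
  shows "Pr (\<lambda>\<pi>. \<Delta> \<pi> \<and> nonconst \<pi> \<psi>) \<le> (1 + real d) * (\<theta> * sqrt (leaves \<psi>)) * Pr \<Delta>"
proof (cases "\<theta> * sqrt (leaves \<psi>) \<ge> 1")
  case True
  have "Pr (\<lambda>\<pi>. \<Delta> \<pi> \<and> nonconst \<pi> \<psi>) \<le> 1 * 1 * Pr \<Delta>" by simp (rule Pr_mono, simp)
  also have "\<dots> \<le> (1 + real d) * (\<theta> * sqrt (leaves \<psi>)) * Pr \<Delta>"
    using True by (intro mult_right_mono mult_mono Pr_nonneg) auto
  finally show ?thesis .
next
  case False
  let ?t = "\<theta> * sqrt (leaves \<psi>)"
  have "Pr (\<lambda>\<pi>. \<Delta> \<pi> \<and> nonconst \<pi> \<psi>) \<le>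
    Pr (\<lambda>\<pi>. (\<Delta> \<pi> \<and> some_literal \<pi> \<psi>) \<or> (\<Delta> \<pi> \<and> nonconst \<pi> \<psi> \<and> \<not> some_literal \<pi> \<psi>))"
    by (intro Pr_mono) auto
  also have "\<dots> \<le> ?t * Pr \<Delta> + \<theta>\<^sup>2 * gate_weight \<psi> * Pr \<Delta>"
    by (intro order_trans[OF Pr_disj] add_mono Pr_some_literal_le Pr_complex_le assms)
  also have "\<theta>\<^sup>2 * gate_weight \<psi> \<le> \<theta>\<^sup>2 * (d * real (leaves \<psi>))"
    using assms(3) by (intro mult_left_mono order_trans[OF gate_weight_le] mult_right_mono) auto
  also have "\<dots> = d * (?t * ?t)" by (simp add: power2_eq_square)
  also have "\<dots> \<le> d * (?t * 1)" using False \<theta>_nonneg by (intro mult_left_mono) auto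
  finally show ?thesis using Pr_nonneg by (simp add: algebra_simps mult_right_mono)
qed

text \<open>If one input of a gate has become a literal, the gate only depends on the other input under the value of the
  literal that does not decide the gate. Hence, unless the gate is a hit, it collapses to a constant or a literal.\<close>

definition hit where
  "hit \<tau> \<pi> \<phi> \<psi> \<longleftrightarrow> (\<exists>k\<in>I. \<exists>\<sigma>. is_literal \<pi> \<phi> k \<sigma> \<and> nonconst (fix_block \<pi> k (\<sigma> = \<tau>)) \<psi>)"

primrec hits :: "('i \<Rightarrow> ('j \<Rightarrow> bool) \<times> ('j \<Rightarrow> bool)) \<Rightarrow> ('i \<times> 'j) formula \<Rightarrow> nat" where
  "hits \<pi> (Lit v s) = 0"
| "hits \<pi> (And \<phi> \<psi>) = hits \<pi> \<phi> + hits \<pi> \<psi> + of_bool (hit True \<pi> \<phi> \<psi>) + of_bool (hit True \<pi> \<psi> \<phi>)"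
| "hits \<pi> (Or \<phi> \<psi>) = hits \<pi> \<phi> + hits \<pi> \<psi> + of_bool (hit False \<pi> \<phi> \<psi>) + of_bool (hit False \<pi> \<psi> \<phi>)"

lemma hits_gate [simp]:
  "hits \<pi> (gate \<tau> \<phi> \<psi>) = hits \<pi> \<phi> + hits \<pi> \<psi> + of_bool (hit \<tau> \<pi> \<phi> \<psi>) + of_bool (hit \<tau> \<pi> \<psi> \<phi>)"
  by (simp add: gate_def)

text \<open>The literal probability of \<phi> multiplies the nonconstancy probability of \<psi>;
  each supplies one \<theta> and one square root.\<close>

lemma Pr_hit_le:
  assumes "vars \<phi> \<subseteq> I \<times> J" "vars \<psi> \<subseteq> I \<times> J" "depth \<psi> \<le> d"
  shows "Pr (\<lambda>\<pi>. hit \<tau> \<pi> \<phi> \<psi>) \<le> (1 + real d) * \<theta>\<^sup>2 * (sqrt (leaves \<phi>) * sqrt (leaves \<psi>))"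
proof -
  have "closed_event (\<lambda>_. True)" by (simp add: closed_event_def)
  from Pr_some_literal_and_le[OF this assms(1), of "(1 + real d) * (\<theta> * sqrt (leaves \<psi>))" "\<lambda>\<pi>. nonconst \<pi> \<psi>" \<tau>]
  show ?thesis using Pr_nonconst_le[OF _ assms(2,3)] \<theta>_nonneg
    by (simp add: hit_def Pr_True power2_eq_square mult_ac)
qed

text \<open>Linearity over the gates, with one \<open>d\<close> for all subformulas; the 2 counts
  the two orders of the children.\<close>

lemma expect_hits_le:
  assumes "vars \<psi> \<subseteq> I \<times> J" "depth \<psi> \<le> d"
  shows "expect (\<lambda>\<pi>. real (hits \<pi> \<psi>)) \<le> 2 * (1 + real d) * \<theta>\<^sup>2 * gate_weight \<psi>"
  using assms
proof (induction \<psi> rule: formula_gate_induct)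
  case (Lit v s)
  then show ?case by (simp add: expect_def)
next
  case (gate \<tau> \<phi> \<psi>)
  have "Pr (\<lambda>\<pi>. hit \<tau> \<pi> \<phi> \<psi>) \<le> (1 + real d) * \<theta>\<^sup>2 * (sqrt (leaves \<phi>) * sqrt (leaves \<psi>))"
    "Pr (\<lambda>\<pi>. hit \<tau> \<pi> \<psi> \<phi>) \<le> (1 + real d) * \<theta>\<^sup>2 * (sqrt (leaves \<psi>) * sqrt (leaves \<phi>))"
    using gate.prems by (auto intro!: Pr_hit_le)
  moreover have "expect (\<lambda>\<pi>. real (hits \<pi> (gate \<tau> \<phi> \<psi>))) =
     expect (\<lambda>\<pi>. real (hits \<pi> \<phi>)) + expect (\<lambda>\<pi>. real (hits \<pi> \<psi>)) + Pr (\<lambda>\<pi>. hit \<tau> \<pi> \<phi> \<psi>) + Pr (\<lambda>\<pi>. hit \<tau> \<pi> \<psi> \<phi>)"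
    by (simp add: expect_add Pr_def)
  moreover have "expect (\<lambda>\<pi>. real (hits \<pi> \<phi>)) \<le> 2 * (1 + real d) * \<theta>\<^sup>2 * gate_weight \<phi>"
    "expect (\<lambda>\<pi>. real (hits \<pi> \<psi>)) \<le> 2 * (1 + real d) * \<theta>\<^sup>2 * gate_weight \<psi>"
    using gate by auto
  ultimately show ?case by (simp add: algebra_simps)
qed

text \<open>If the fixing makes \<psi> constant, the gate depends on \<open>y\<^sub>k\<close> at
  most. Otherwise there is a hit, which pays for two leaves: the literal in front, and \<psi> in
  case it was itself a free literal.\<close>

lemma gate_literal_simple:
  assumes k: "k \<in> I" "is_literal \<pi> \<phi> k \<sigma>"
    and \<psi>: "simple_up_to I (2 * N) (\<lambda>y. eval_formula \<psi> (proj \<pi> y))"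
  shows "simple_up_to I (2 * (N + of_bool (hit \<tau> \<pi> \<phi> \<psi>))) (\<lambda>y. eval_formula (gate \<tau> \<phi> \<psi>) (proj \<pi> y))"
proof (cases "nonconst (fix_block \<pi> k (\<sigma> = \<tau>)) \<psi>")
  case False
  then obtain c where c: "\<And>y. eval_formula \<psi> (proj \<pi> (y(k := (\<sigma> = \<tau>)))) = c"
    unfolding nonconst_def proj_fix_block by blast
  \<comment> \<open>For \<open>y k = (\<sigma> = \<tau>)\<close> the literal is \<tau> and the gate
    copies \<psi>; otherwise the literal is \<open>\<not> \<tau>\<close> and decides the
    gate.\<close>
  have "eval_formula (gate \<tau> \<phi> \<psi>) (proj \<pi> y) = (if c = \<tau> then y k = \<sigma> else c)" for y
  proof (cases "y k = (\<sigma> = \<tau>)")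
    case True
    hence "eval_formula \<psi> (proj \<pi> y) = c" using c[of y] by (simp add: fun_upd_idem)
    moreover have "eval_formula \<phi> (proj \<pi> y) = (y k = \<sigma>)" using k(2) by (simp add: is_literal_def)
    ultimately show ?thesis using True by (cases \<sigma>; cases \<tau>; cases c) simp_all
  next
    case False
    moreover have "eval_formula \<phi> (proj \<pi> y) = (y k = \<sigma>)" using k(2) by (simp add: is_literal_def)
    ultimately show ?thesis by (cases \<sigma>; cases \<tau>; cases c) simp_all
  qed
  thus ?thesis using k(1) unfolding simple_up_to_def by (cases "c = \<tau>") auto
next
  case True
  hence hit: "hit \<tau> \<pi> \<phi> \<psi>" using k by (auto simp: hit_def)
  have lit: "eval_formula (gate \<tau> \<phi> \<psi>) (proj \<pi> y) = eval_formula (gate \<tau> (Lit k \<sigma>) \<psi>') y"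
    if "eval_formula \<psi>' y = eval_formula \<psi> (proj \<pi> y)" for \<psi>' y
    using k(2) that by (simp add: is_literal_def)
  have build: ?thesis if "vars \<psi>' \<subseteq> I" "\<And>y. eval_formula \<psi>' y = eval_formula \<psi> (proj \<pi> y)" "leaves \<psi>' \<le> 2 * N + 1" for \<psi>'
  proof -
    have "vars (gate \<tau> (Lit k \<sigma>) \<psi>') \<subseteq> I" "leaves (gate \<tau> (Lit k \<sigma>) \<psi>') \<le> 2 * (N + of_bool (hit \<tau> \<pi> \<phi> \<psi>))"
      using that k(1) hit by auto
    thus ?thesis using lit[OF that(2)] unfolding simple_up_to_def by metis
  qed
  from \<psi> show ?thesis
  proof (cases rule: simple_up_to_cases)
    case (const c)
    hence False using True unfolding nonconst_def proj_fix_block by blast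
    thus ?thesis ..
  next
    case (literal k' \<sigma>')
    thus ?thesis by (intro build[of "Lit k' \<sigma>'"]) auto
  next
    case (formula \<psi>')
    thus ?thesis by (intro build[of \<psi>']) auto
  qed
qed

text \<open>A constant input removes the gate and two formulas add their sizes; only a literal
  input, treated in \<open>gate_literal_simple\<close>, may consume a hit.\<close>

lemma projection_simple:
  assumes "vars \<psi> \<subseteq> I \<times> J"
  shows "simple_up_to I (2 * hits \<pi> \<psi>) (\<lambda>y. eval_formula \<psi> (proj \<pi> y))"
  using assms
proof (induction \<psi> rule: formula_gate_induct)
  case (Lit p s)
  obtain i j where p: "p = (i, j)" "i \<in> I" using Lit by (cases p) auto
  show ?case
  proof (cases "fst (\<pi> i) j = snd (\<pi> i) j")
    case True
    thus ?thesis by (auto simp: simple_up_to_def p proj_def sel_def)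
  next
    case False
    hence "\<forall>y. eval_formula (Lit p s) (proj \<pi> y) = (y i = (snd (\<pi> i) j = s))"
      by (auto simp: p proj_def sel_def)
    thus ?thesis using p(2) unfolding simple_up_to_def by blast
  qed
next
  case (gate \<tau> \<phi> \<psi>)
  let ?ev = "\<lambda>\<psi> y. eval_formula \<psi> (proj \<pi> y)"
  have S: "simple_up_to I (2 * hits \<pi> \<phi>) (?ev \<phi>)" "simple_up_to I (2 * hits \<pi> \<psi>) (?ev \<psi>)"
    using gate by auto
  have comm: "?ev (gate \<tau> \<psi> \<phi>) = ?ev (gate \<tau> \<phi> \<psi>)" by auto
  consider (const1) c where "\<And>y. ?ev \<phi> y = c" | (const2) c where "\<And>y. ?ev \<psi> y = c"
    | (lit1) k \<sigma> where "k \<in> I" "is_literal \<pi> \<phi> k \<sigma>" | (lit2) k \<sigma> where "k \<in> I" "is_literal \<pi> \<psi> k \<sigma>"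
    | (big) \<phi>' \<psi>' where "vars \<phi>' \<subseteq> I" "\<And>y. eval_formula \<phi>' y = ?ev \<phi> y" "leaves \<phi>' \<le> 2 * hits \<pi> \<phi>"
       "vars \<psi>' \<subseteq> I" "\<And>y. eval_formula \<psi>' y = ?ev \<psi> y" "leaves \<psi>' \<le> 2 * hits \<pi> \<psi>"
  proof -
    from S(1) show thesis
    proof (cases rule: simple_up_to_cases)
      case \<phi>: (formula \<phi>')
      from S(2) show thesis
      proof (cases rule: simple_up_to_cases)
        case (formula \<psi>')
        show thesis by (rule big[OF \<phi> formula])
      next
        case (const c)
        show thesis by (rule const2[OF const])
      next
        case (literal k \<sigma>)
        show thesis by (rule lit2[of k \<sigma>]) (simp_all add: literal is_literal_def)
      qed
    next
      case (const c)
      show thesis by (rule const1[OF const])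
    next
      case (literal k \<sigma>)
      show thesis by (rule lit1[of k \<sigma>]) (simp_all add: literal is_literal_def)
    qed
  qed
  thus ?case
  proof cases
    case const1
    show ?thesis
    proof (cases "c = \<tau>")
      case True
      hence "?ev (gate \<tau> \<phi> \<psi>) = ?ev \<psi>" using const1 by auto
      thus ?thesis using simple_up_to_mono[OF S(2)] by simp
    next
      case False
      hence "?ev (gate \<tau> \<phi> \<psi>) y = c" for y using const1 by auto
      thus ?thesis by (auto simp: simple_up_to_def)
    qed
  next
    case const2
    show ?thesis
    proof (cases "c = \<tau>")
      case True
      hence "?ev (gate \<tau> \<phi> \<psi>) = ?ev \<phi>" using const2 by auto
      thus ?thesis using simple_up_to_mono[OF S(1)] by simp
    next
      case False
      hence "?ev (gate \<tau> \<phi> \<psi>) y = c" for y using const2 by auto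
      thus ?thesis by (auto simp: simple_up_to_def)
    qed
  next
    case lit1
    show ?thesis
      by (rule simple_up_to_mono[OF gate_literal_simple[OF lit1 S(2)]]) simp
  next
    case lit2
    show ?thesis
      by (rule simple_up_to_mono[OF gate_literal_simple[OF lit2 S(1), of \<tau>, unfolded comm]]) simp
  next
    case big
    have "vars (gate \<tau> \<phi>' \<psi>') \<subseteq> I" "leaves (gate \<tau> \<phi>' \<psi>') \<le> 2 * hits \<pi> (gate \<tau> \<phi> \<psi>)"
      using big by auto
    moreover have "eval_formula (gate \<tau> \<phi>' \<psi>') y = ?ev (gate \<tau> \<phi> \<psi>) y" for y
      using big by simp
    ultimately show ?thesis unfolding simple_up_to_def by blast
  qed
qed

end

section \<open>Shrinkage under random projections\<close>

context block_projection
begin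

text \<open>A free literal still has one leaf, hence the subtraction of 1; the free constants are
  excluded because \<open>f\<close> is not constant.\<close>

lemma complexity_le_hits:
  assumes vars: "vars \<psi> \<subseteq> I \<times> J" and f: "\<not> f constant_on cube I"
    and \<psi>: "\<And>y. y \<in> cube I \<Longrightarrow> eval_formula \<psi> (proj \<pi> y) = f y"
  shows "real (formula_complexity I f) - 1 \<le> 2 * real (hits \<pi> \<psi>)"
  using projection_simple[OF vars, of \<pi>]
proof (cases rule: simple_up_to_cases)
  case (const c)
  hence "f constant_on cube I" unfolding constant_on_def by (intro exI[of _ c]) (simp add: \<psi>[symmetric])
  thus ?thesis using f by blast
next
  case (literal k \<sigma>)
  hence "computes I (Lit k \<sigma>) f" by (auto simp: computes_def \<psi>[symmetric])
  from formula_complexity_le[OF this] show ?thesis by simp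
next
  case (formula \<phi>)
  hence "computes I \<phi> f" by (auto simp: computes_def \<psi>[symmetric])
  from formula_complexity_le[OF this] formula(3) show ?thesis by simp
qed

lemma Pr_all_alive:
  "Pr (\<lambda>\<pi>. \<forall>i\<in>I. fst (\<pi> i) \<noteq> snd (\<pi> i)) = (\<Sum>q\<in>X \<times> X. w q * of_bool (fst q \<noteq> snd q)) ^ card I"
proof -
  have "of_bool (\<forall>i\<in>I. fst (\<pi> i) \<noteq> snd (\<pi> i)) = (\<Prod>i\<in>I. of_bool (fst (\<pi> i) \<noteq> snd (\<pi> i)) :: real)" for \<pi> :: "'i \<Rightarrow> ('j \<Rightarrow> bool) \<times> ('j \<Rightarrow> bool)"
    using finite_I by (auto simp: prod_zero_iff)
  hence "Pr (\<lambda>\<pi>. \<forall>i\<in>I. fst (\<pi> i) \<noteq> snd (\<pi> i)) =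
     (\<Sum>\<pi>\<in>I \<rightarrow>\<^sub>E X \<times> X. \<Prod>i\<in>I. w (\<pi> i) * of_bool (fst (\<pi> i) \<noteq> snd (\<pi> i)))"
    unfolding Pr_def expect_def weight_def by (simp only: prod.distrib)
  also have "\<dots> = (\<Sum>q\<in>X \<times> X. w q * of_bool (fst q \<noteq> snd q)) ^ card I"
    using prod_sum_PiE[of I "\<lambda>_. X \<times> X" "\<lambda>_ q. w q * of_bool (fst q \<noteq> snd q)"] finite_I finite_X
    by simp
  finally show ?thesis .
qed

text \<open>Whenever all blocks are alive the projected formula computes \<open>f\<close>, which
  forces many hits. One factor \<open>1 + d\<close> stems from the nonconstancy bound, the other
  from \<open>gate_weight_le\<close>.\<close>

lemma shrinkage_bound:
  assumes vars: "vars \<psi> \<subseteq> I \<times> J" and d: "depth \<psi> \<le> d" and f: "\<not> f constant_on cube I"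
    and alive: "\<And>\<pi> y. \<pi> \<in> I \<rightarrow>\<^sub>E X \<times> X \<Longrightarrow> \<forall>i\<in>I. fst (\<pi> i) \<noteq> snd (\<pi> i) \<and> w (\<pi> i) > 0 \<Longrightarrow> y \<in> cube I \<Longrightarrow>
       eval_formula \<psi> (proj \<pi> y) = f y"
  shows "(real (formula_complexity I f) - 1) * Pr (\<lambda>\<pi>. \<forall>i\<in>I. fst (\<pi> i) \<noteq> snd (\<pi> i))
    \<le> 4 * (1 + real d)\<^sup>2 * \<theta>\<^sup>2 * leaves \<psi>"
proof -
  let ?L = "real (formula_complexity I f) - 1"
  have "?L * Pr (\<lambda>\<pi>. \<forall>i\<in>I. fst (\<pi> i) \<noteq> snd (\<pi> i)) =
     (\<Sum>\<pi>\<in>I \<rightarrow>\<^sub>E X \<times> X. weight I \<pi> * (?L * of_bool (\<forall>i\<in>I. fst (\<pi> i) \<noteq> snd (\<pi> i))))"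
    unfolding Pr_def expect_def by (simp add: sum_distrib_left mult_ac)
  also have "\<dots> \<le> (\<Sum>\<pi>\<in>I \<rightarrow>\<^sub>E X \<times> X. weight I \<pi> * (2 * real (hits \<pi> \<psi>)))"
  proof (rule sum_mono)
    fix \<pi> assume \<pi>: "\<pi> \<in> I \<rightarrow>\<^sub>E X \<times> X"
    show "weight I \<pi> * (?L * of_bool (\<forall>i\<in>I. fst (\<pi> i) \<noteq> snd (\<pi> i))) \<le> weight I \<pi> * (2 * real (hits \<pi> \<psi>))"
    proof (cases "(\<forall>i\<in>I. fst (\<pi> i) \<noteq> snd (\<pi> i)) \<and> weight I \<pi> \<noteq> 0")
      case True
      hence "\<forall>i\<in>I. fst (\<pi> i) \<noteq> snd (\<pi> i) \<and> w (\<pi> i) > 0"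
        using w_nonneg finite_I by (auto simp: weight_def less_le)
      hence "?L \<le> 2 * real (hits \<pi> \<psi>)"
        using alive[OF \<pi>] by (intro complexity_le_hits vars f) auto
      thus ?thesis using True weight_nonneg[of I \<pi>] by (simp add: mult_left_mono)
    next
      case False
      have "0 \<le> weight I \<pi> * (2 * real (hits \<pi> \<psi>))" using weight_nonneg by simp
      moreover have "weight I \<pi> * (?L * of_bool (\<forall>i\<in>I. fst (\<pi> i) \<noteq> snd (\<pi> i))) = 0" using False by auto
      ultimately show ?thesis by linarith
    qed
  qed
  also have "\<dots> = 2 * expect (\<lambda>\<pi>. real (hits \<pi> \<psi>))"
    unfolding expect_def by (simp add: sum_distrib_left mult_ac)
  also have "\<dots> \<le> 2 * (2 * (1 + real d) * \<theta>\<^sup>2 * gate_weight \<psi>)"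
    using expect_hits_le[OF vars d] by simp
  also have "\<dots> \<le> 2 * (2 * (1 + real d) * \<theta>\<^sup>2 * ((1 + real d) * leaves \<psi>))"
    using d by (intro mult_left_mono order_trans[OF gate_weight_le] mult_right_mono) auto
  finally show ?thesis by (simp add: power2_eq_square algebra_simps)
qed

end

section \<open>Application to block compositions\<close>

lemma sum_diagonal:
  assumes "finite X"
  shows "(\<Sum>(u, v)\<in>X \<times> X. if u = v then D u else 0) = (\<Sum>u\<in>X. D u :: real)"
  unfolding sum.cartesian_product[symmetric] using assms by simp

text \<open>The numbers \<open>q\<^sub>1\<close> and \<open>q\<^sub>0\<close> bound the conditional
  probability that a coordinate differs, given the accepted or the rejected input; the conditions
  are multiplied out to avoid division.\<close>

theorem composition_bound:
  fixes f g :: "(nat \<Rightarrow> bool) \<Rightarrow> bool" and p :: "((nat \<Rightarrow> bool) \<times> (nat \<Rightarrow> bool)) pmf" and m n :: nat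
  defines "X \<equiv> cube {..<n}"
  assumes f: "\<not> f constant_on cube {..<m}"
    and p: "set_pmf p \<subseteq> {a \<in> X. g a} \<times> {b \<in> X. \<not> g b}"
    and q: "q\<^sub>0 \<ge> 0" "q\<^sub>1 \<ge> 0"
    and q1: "\<And>a j. a \<in> X \<Longrightarrow> j < n \<Longrightarrow> (\<Sum>b\<in>X. pmf p (a, b) * of_bool (a j \<noteq> b j)) \<le> q\<^sub>1 * (\<Sum>b\<in>X. pmf p (a, b))"
    and q0: "\<And>b j. b \<in> X \<Longrightarrow> j < n \<Longrightarrow> (\<Sum>a\<in>X. pmf p (a, b) * of_bool (a j \<noteq> b j)) \<le> q\<^sub>0 * (\<Sum>a\<in>X. pmf p (a, b))"
    and \<phi>: "computes ({..<m} \<times> {..<n}) \<phi> (block_comp m n f g)"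
  shows "real (formula_complexity {..<m} f) - 1 \<le> 128 * real m ^ 4 * (q\<^sub>0 * q\<^sub>1) * (1 + real (depth \<phi>))\<^sup>2 * leaves \<phi>"
proof -
  note m = nonconstant_cube_pos[OF f]
  have finX: "finite X" unfolding X_def cube_def by (intro finite_PiE) auto
  have total: "(\<Sum>q\<in>X \<times> X. pmf p q) = 1"
    using p finX by (intro sum_pmf_eq_1) auto
  \<comment> \<open>The diagonal weight of \<open>w\<close> therefore comes from the fixing part
    alone.\<close>
  have P0: "pmf p (u, u) = 0" for u using p by (auto simp: set_pmf_iff)
  \<comment> \<open>\<open>D\<close> adds both marginals and has total mass 2, so
    \<open>D u / (4 * m)\<close> has total mass \<open>1 / (2 * m)\<close>, the probability of
    fixing a block. Pairs of \<open>p\<close> enter \<open>w\<close> swapped because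
    \<open>y\<^sub>i = 1\<close> must select the input accepted by \<open>g\<close>.\<close>
  define D where "D u = (\<Sum>b\<in>X. pmf p (u, b)) + (\<Sum>a\<in>X. pmf p (a, u))" for u
  define w where "w = (\<lambda>(u, v). (if u = v then D u / (4 * m) else 0) + (1 - 1 / (2 * m)) * pmf p (v, u))"
  have D_nonneg: "D u \<ge> 0" for u by (auto simp: D_def intro!: add_nonneg_nonneg sum_nonneg)
  have m1: "0 < 1 - 1 / (2 * real m)" "1 - 1 / (2 * real m) \<le> 1" using m by (auto simp: field_simps)
  have sumD: "(\<Sum>u\<in>X. D u) = 2"
  proof -
    have "(\<Sum>u\<in>X. \<Sum>b\<in>X. pmf p (u, b)) = 1" using total by (simp add: sum.cartesian_product)
    moreover from this have "(\<Sum>u\<in>X. \<Sum>a\<in>X. pmf p (a, u)) = 1" by (subst sum.swap)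
    ultimately show ?thesis by (simp add: D_def sum.distrib)
  qed
  have swap: "(\<Sum>(u, v)\<in>X \<times> X. pmf p (v, u)) = 1"
    using total unfolding sum.cartesian_product[symmetric] by (subst sum.swap) (simp add: sum.cartesian_product)
  have D_pos: "D u > 0 \<and> D v > 0" if "u \<in> X" "v \<in> X" "pmf p (v, u) > 0" for u v
  proof
    have "pmf p (v, u) \<le> (\<Sum>a\<in>X. pmf p (a, u))" using that finX by (intro member_le_sum) auto
    moreover have "0 \<le> (\<Sum>b\<in>X. pmf p (u, b))" by (intro sum_nonneg) auto
    ultimately show "D u > 0" using that by (simp add: D_def)
    have "pmf p (v, u) \<le> (\<Sum>b\<in>X. pmf p (v, b))" using that finX by (intro member_le_sum) auto
    moreover have "0 \<le> (\<Sum>a\<in>X. pmf p (a, v))" by (intro sum_nonneg) auto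
    ultimately show "D v > 0" using that by (simp add: D_def)
  qed
  \<comment> \<open>Since \<open>w (u, u) = D u / (4 * m)\<close>, a bound by \<open>q * D u\<close>
    is a bound by \<open>4 * m * q * w (u, u)\<close>.\<close>
  interpret block_projection "{..<m}" "{..<n}" X w "4 * real m * q\<^sub>0" "4 * real m * q\<^sub>1"
  proof
    show "w q \<ge> 0" for q
      unfolding w_def using D_nonneg m1 by (auto simp: case_prod_unfold intro!: add_nonneg_nonneg mult_nonneg_nonneg)
    have "(\<Sum>q\<in>X \<times> X. w q) = (\<Sum>(u, v)\<in>X \<times> X. if u = v then D u / (4 * m) else 0) +
       (1 - 1 / (2 * m)) * (\<Sum>(u, v)\<in>X \<times> X. pmf p (v, u))"
      unfolding w_def case_prod_unfold by (simp add: sum.distrib sum_distrib_left)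
    also have "\<dots> = 1"
      unfolding swap sum_diagonal[OF finX] sum_divide_distrib[symmetric] sumD by simp
    finally show "(\<Sum>q\<in>X \<times> X. w q) = 1" .
    show "w (u, u) > 0 \<and> w (v, v) > 0" if uv: "u \<in> X" "v \<in> X" "w (u, v) > 0" for u v
    proof (cases "u = v")
      case False
      hence "pmf p (v, u) > 0" using uv(3) m1 by (simp add: w_def zero_less_mult_iff)
      thus ?thesis using D_pos[OF uv(1,2)] m by (simp add: w_def P0)
    qed (use uv in auto)
    show "(\<Sum>v\<in>X. w (u, v) * of_bool (v j \<noteq> u j)) \<le> 4 * real m * q\<^sub>0 * w (u, u)" if "u \<in> X" "j \<in> {..<n}" for u j
    proof -
      have "(\<Sum>v\<in>X. w (u, v) * of_bool (v j \<noteq> u j)) \<le> (\<Sum>v\<in>X. pmf p (v, u) * of_bool (v j \<noteq> u j))"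
        unfolding w_def using m1 by (intro sum_mono) (auto intro: mult_left_le_one_le)
      also have "\<dots> \<le> q\<^sub>0 * (\<Sum>a\<in>X. pmf p (a, u))" using q0 that by auto
      also have "\<dots> \<le> q\<^sub>0 * D u" using q by (intro mult_left_mono) (auto simp: D_def intro!: sum_nonneg)
      finally show ?thesis using m by (simp add: w_def P0)
    qed
    show "(\<Sum>u\<in>X. w (u, v) * of_bool (v j \<noteq> u j)) \<le> 4 * real m * q\<^sub>1 * w (v, v)" if "v \<in> X" "j \<in> {..<n}" for v j
    proof -
      have "(\<Sum>u\<in>X. w (u, v) * of_bool (v j \<noteq> u j)) \<le> (\<Sum>u\<in>X. pmf p (v, u) * of_bool (v j \<noteq> u j))"
        unfolding w_def using m1 by (intro sum_mono) (auto intro: mult_left_le_one_le)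
      also have "\<dots> \<le> q\<^sub>1 * (\<Sum>b\<in>X. pmf p (v, b))" using q1 that by auto
      also have "\<dots> \<le> q\<^sub>1 * D v" using q by (intro mult_left_mono) (auto simp: D_def intro!: sum_nonneg)
      finally show ?thesis using m by (simp add: w_def P0)
    qed
  qed (use finX q in auto)
  have off: "(\<Sum>q\<in>X \<times> X. w q * of_bool (fst q \<noteq> snd q)) = 1 - 1 / (2 * m)"
  proof -
    have "(\<Sum>q\<in>X \<times> X. w q * of_bool (fst q \<noteq> snd q)) = (\<Sum>q\<in>X \<times> X. (1 - 1 / (2 * m)) * (case q of (u, v) \<Rightarrow> pmf p (v, u)))"
      by (intro sum.cong refl) (auto simp: w_def P0)
    thus ?thesis unfolding sum_distrib_left[symmetric] swap by simp
  qed
  \<comment> \<open>Bernoulli's inequality: with probability at least 1/2 no block is fixed.\<close>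
  have "1 / 2 \<le> 1 + real m * (- (1 / (2 * m)))" using m by simp
  also have "\<dots> \<le> (1 - 1 / (2 * m)) ^ m"
    using Bernoulli_inequality[of "- (1 / (2 * real m))" m] m by (simp add: field_simps)
  finally have alive_half: "1 / 2 \<le> Pr (\<lambda>\<pi>. \<forall>i\<in>{..<m}. fst (\<pi> i) \<noteq> snd (\<pi> i))"
    unfolding Pr_all_alive off by simp
  have alive: "eval_formula \<phi> (proj \<pi> y) = f y"
    if \<pi>: "\<pi> \<in> {..<m} \<rightarrow>\<^sub>E X \<times> X" "\<forall>i\<in>{..<m}. fst (\<pi> i) \<noteq> snd (\<pi> i) \<and> w (\<pi> i) > 0" and y: "y \<in> cube {..<m}" for \<pi> y
  proof -
    have g: "sel (y i) (\<pi> i) \<in> X \<and> g (sel (y i) (\<pi> i)) = y i" if "i < m" for i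
    proof -
      obtain u v where uv: "\<pi> i = (u, v)" by (cases "\<pi> i")
      hence "u \<noteq> v" "w (u, v) > 0" using bspec[OF \<pi>(2), of i] that by simp_all
      hence "pmf p (snd (\<pi> i), fst (\<pi> i)) \<noteq> 0" unfolding uv by (auto simp: w_def)
      hence "(snd (\<pi> i), fst (\<pi> i)) \<in> set_pmf p" by (simp add: set_pmf_iff)
      thus ?thesis using p by (cases "y i") auto
    qed
    \<comment> \<open>\<open>computes\<close> speaks of extensional inputs only, while
      \<open>proj\<close> has values outside the index set as well.\<close>
    let ?x = "restrict (proj \<pi> y) ({..<m} \<times> {..<n})"
    have "eval_formula \<phi> (proj \<pi> y) = eval_formula \<phi> ?x"
      using \<phi> by (intro eval_formula_cong) (auto simp: computes_def)
    also have "\<dots> = block_comp m n f g ?x"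
      using \<phi> by (auto simp: computes_def cube_def)
    also have "\<dots> = f (\<lambda>i\<in>{..<m}. g (\<lambda>j\<in>{..<n}. sel (y i) (\<pi> i) j))"
      unfolding block_comp_def
      by (intro arg_cong[of _ _ f] restrict_ext arg_cong[of _ _ g]) (auto simp: proj_def)
    also have "(\<lambda>i\<in>{..<m}. g (\<lambda>j\<in>{..<n}. sel (y i) (\<pi> i) j)) = restrict y {..<m}"
    proof (intro restrict_ext)
      fix i assume "i \<in> {..<m}"
      hence g': "sel (y i) (\<pi> i) \<in> X" "g (sel (y i) (\<pi> i)) = y i" using g by auto
      have "restrict (sel (y i) (\<pi> i)) {..<n} = sel (y i) (\<pi> i)"
        using g'(1) unfolding X_def cube_def by (rule PiE_restrict)
      thus "g (\<lambda>j\<in>{..<n}. sel (y i) (\<pi> i) j) = y i" using g'(2) by simp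
    qed
    also have "restrict y {..<m} = y" using y unfolding cube_def by (rule PiE_restrict)
    finally show ?thesis .
  qed
  have "(real (formula_complexity {..<m} f) - 1) * (1 / 2) \<le> 4 * (1 + real (depth \<phi>))\<^sup>2 * \<theta>\<^sup>2 * leaves \<phi>"
  proof (cases "real (formula_complexity {..<m} f) - 1 \<ge> 0")
    case True
    hence "(real (formula_complexity {..<m} f) - 1) * (1 / 2) \<le>
       (real (formula_complexity {..<m} f) - 1) * Pr (\<lambda>\<pi>. \<forall>i\<in>{..<m}. fst (\<pi> i) \<noteq> snd (\<pi> i))"
      using alive_half by (intro mult_left_mono)
    also have "\<dots> \<le> 4 * (1 + real (depth \<phi>))\<^sup>2 * \<theta>\<^sup>2 * leaves \<phi>"
      using \<phi> alive by (intro shrinkage_bound f) (auto simp: computes_def)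
    finally show ?thesis .
  next
    case False
    hence "(real (formula_complexity {..<m} f) - 1) * (1 / 2) \<le> 0" by simp
    also have "0 \<le> 4 * (1 + real (depth \<phi>))\<^sup>2 * \<theta>\<^sup>2 * leaves \<phi>" by simp
    finally show ?thesis .
  qed
  \<comment> \<open>Two factors \<open>m\<close> come from \<open>card I\<close> and two from the
    constants \<open>4 * m * q\<close>; the final 128 is 2 * 4 * 16.\<close>
  also have "\<theta>\<^sup>2 = 16 * real m ^ 4 * (q\<^sub>0 * q\<^sub>1)"
    unfolding \<theta>_def using q by (simp add: power_mult_distrib) (simp add: eval_nat_numeral)
  finally show ?thesis by (simp add: mult_ac)
qed

section \<open>Soft-adversary values as real numbers\<close>

text \<open>Every term is at least 1 because probabilities are at most 1. The general
  \<open>h\<close> covers both \<open>fst\<close> and \<open>snd\<close>, and the last inequality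
  also holds for \<open>a\<close> outside the support, where both sides vanish.\<close>

lemma adversary_factor:
  fixes p :: "'z pmf" and h :: "'z \<Rightarrow> 'x" and dif :: "'i \<Rightarrow> 'z \<Rightarrow> bool"
  assumes dif: "\<And>z. z \<in> set_pmf p \<Longrightarrow> \<exists>i\<in>I. dif i z"
  obtains v where "v \<ge> 1"
    "(INF a \<in> set_pmf (map_pmf h p). INF i \<in> I. 1 / ereal (\<P>(z in measure_pmf p. dif i z \<bar> h z = a))) = ereal v"
    "\<And>a i. i \<in> I \<Longrightarrow> measure_pmf.prob p {z. dif i z \<and> h z = a} \<le> 1 / v * measure_pmf.prob p {z. h z = a}"
proof -
  define r where "r i a = measure_pmf.prob p {z. dif i z \<and> h z = a} / measure_pmf.prob p {z. h z = a}" for i a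
  have r: "\<P>(z in measure_pmf p. dif i z \<bar> h z = a) = r i a" for i a
    by (simp add: cond_prob_def r_def)
  have le: "measure_pmf.prob p {z. dif i z \<and> h z = a} \<le> measure_pmf.prob p {z. h z = a}" for i a
    by (intro measure_pmf.finite_measure_mono) auto
  have r01: "0 \<le> r i a" "r i a \<le> 1" for i a
    using le[of i a] by (auto simp: r_def divide_le_eq_1 zero_less_measure_iff)
  define V where "V = (INF a \<in> set_pmf (map_pmf h p). INF i \<in> I. 1 / ereal (r i a))"
  have "1 \<le> V" unfolding V_def
  proof (intro INF_greatest)
    fix a i
    show "1 \<le> 1 / ereal (r i a)"
      using r01[of i a] by (cases "r i a = 0") (auto simp: divide_ereal_def one_ereal_def field_simps)
  qed
  have Vle: "V \<le> ereal (1 / r i a)" if "a \<in> h ` set_pmf p" "i \<in> I" "r i a > 0" for a i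
  proof -
    have "V \<le> 1 / ereal (r i a)" unfolding V_def
      using that by (intro INF_lower2[of a] INF_lower) auto
    also have "\<dots> = ereal (1 / r i a)" using that by (simp add: one_ereal_def)
    finally show ?thesis .
  qed
  \<comment> \<open>A supported pair differs somewhere, so one term of the minimum is
    finite.\<close>
  obtain z0 where z0: "z0 \<in> set_pmf p" using set_pmf_not_empty[of p] by blast
  obtain i0 where i0: "i0 \<in> I" "dif i0 z0" using dif z0 by blast
  have "0 < measure_pmf.prob p {z. dif i0 z \<and> h z = h z0}"
    using z0 i0 by (intro measure_pmf_posI[of z0]) auto
  moreover from this le have "0 < measure_pmf.prob p {z. h z = h z0}" by (rule less_le_trans)
  ultimately have "r i0 (h z0) > 0" by (simp add: r_def)
  from Vle[OF _ i0(1) this] z0 have "V < \<infinity>" by auto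
  then obtain v where v: "V = ereal v" using \<open>1 \<le> V\<close> by (cases V) auto
  have v1: "v \<ge> 1" using \<open>1 \<le> V\<close> v by (simp add: one_ereal_def)
  have "measure_pmf.prob p {z. dif i z \<and> h z = a} \<le> 1 / v * measure_pmf.prob p {z. h z = a}" if i: "i \<in> I" for a i
  proof (cases "measure_pmf.prob p {z. dif i z \<and> h z = a} = 0")
    case False
    hence pos: "measure_pmf.prob p {z. dif i z \<and> h z = a} > 0" by (simp add: zero_less_measure_iff)
    hence pos': "measure_pmf.prob p {z. h z = a} > 0" using le[of i a] by linarith
    have "a \<in> h ` set_pmf p"
    proof (rule ccontr)
      assume "a \<notin> h ` set_pmf p"
      hence "set_pmf p \<inter> {z. h z = a} = {}" by auto
      hence "measure_pmf.prob p {z. h z = a} = 0" by (simp add: measure_pmf_zero_iff)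
      thus False using pos' by simp
    qed
    from Vle[OF this i] have "v \<le> 1 / r i a" using pos pos' v by (simp add: r_def)
    thus ?thesis using pos pos' v1 by (simp add: r_def field_simps)
  qed (use v1 in auto)
  thus ?thesis using that[of v] v v1 unfolding V_def r by blast
qed

lemma prob_finite_support:
  assumes "finite S" "set_pmf p \<subseteq> S"
  shows "measure_pmf.prob p A = (\<Sum>z\<in>S. pmf p z * of_bool (z \<in> A))"
proof -
  have "measure_pmf.prob p A = measure_pmf.prob p (A \<inter> S)"
    using assms(2) by (intro measure_pmf.finite_measure_eq_AE) (auto simp: AE_measure_pmf_iff)
  also have "\<dots> = (\<Sum>z\<in>A \<inter> S. pmf p z)" using assms by (intro measure_measure_pmf_finite) auto
  also have "\<dots> = (\<Sum>z\<in>S. pmf p z * of_bool (z \<in> A))"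
    using assms by (intro sum.mono_neutral_cong_left) auto
  finally show ?thesis .
qed

text \<open>The two minima \<open>v1\<close> and \<open>v0\<close> give
  \<open>q\<^sub>1 = 1 / v1\<close> and \<open>q\<^sub>0 = 1 / v0\<close> in
  \<open>composition_bound\<close>; their product is the value of \<open>p\<close>.\<close>

theorem soft_adv_value_composition_bound:
  fixes f g :: "(nat \<Rightarrow> bool) \<Rightarrow> bool" and p :: "((nat \<Rightarrow> bool) \<times> (nat \<Rightarrow> bool)) pmf"
  assumes f: "\<not> f constant_on cube {..<m}"
    and p: "set_pmf p \<subseteq> {a \<in> cube {..<n}. g a} \<times> {b \<in> cube {..<n}. \<not> g b}"
    and \<phi>: "computes ({..<m} \<times> {..<n}) \<phi> (block_comp m n f g)"
  obtains v where "soft_adv_value {..<n} p = ereal v"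
    "(real (formula_complexity {..<m} f) - 1) * v \<le> 128 * real m ^ 4 * (1 + real (depth \<phi>))\<^sup>2 * leaves \<phi>"
proof -
  let ?X = "cube {..<n}"
  have finX: "finite ?X" unfolding cube_def by (intro finite_PiE) auto
  have pX: "set_pmf p \<subseteq> ?X \<times> ?X" using p by auto
  note prob = prob_finite_support[OF finite_cartesian_product[OF finX finX] pX]
  have dif: "\<exists>i\<in>{..<n}. fst z i \<noteq> snd z i" if "z \<in> set_pmf p" for z
  proof (rule ccontr)
    assume "\<not> ?thesis"
    moreover have "fst z \<in> cube {..<n}" "snd z \<in> cube {..<n}" using pX that by auto
    ultimately have "fst z = snd z" unfolding cube_def by (intro PiE_ext[of "fst z" "{..<n}" "\<lambda>_. UNIV"]) auto
    thus False using p that by auto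
  qed
  obtain v1 where v1: "v1 \<ge> 1"
    "(INF a \<in> set_pmf (map_pmf fst p). INF i \<in> {..<n}. 1 / ereal (\<P>(z in measure_pmf p. fst z i \<noteq> snd z i \<bar> fst z = a))) = ereal v1"
    "\<And>a i. i \<in> {..<n} \<Longrightarrow> measure_pmf.prob p {z. fst z i \<noteq> snd z i \<and> fst z = a} \<le> 1 / v1 * measure_pmf.prob p {z. fst z = a}"
    using adversary_factor[of p "{..<n}" "\<lambda>i z. fst z i \<noteq> snd z i" fst, OF dif] by blast
  obtain v0 where v0: "v0 \<ge> 1"
    "(INF a \<in> set_pmf (map_pmf snd p). INF i \<in> {..<n}. 1 / ereal (\<P>(z in measure_pmf p. fst z i \<noteq> snd z i \<bar> snd z = a))) = ereal v0"
    "\<And>a i. i \<in> {..<n} \<Longrightarrow> measure_pmf.prob p {z. fst z i \<noteq> snd z i \<and> snd z = a} \<le> 1 / v0 * measure_pmf.prob p {z. snd z = a}"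
    using adversary_factor[of p "{..<n}" "\<lambda>i z. fst z i \<noteq> snd z i" snd, OF dif] by blast
  have fst_sum: "measure_pmf.prob p {z. Q z \<and> fst z = a} = (\<Sum>b\<in>?X. pmf p (a, b) * of_bool (Q (a, b)))" if "a \<in> ?X" for a Q
  proof -
    have "measure_pmf.prob p {z. Q z \<and> fst z = a} = (\<Sum>a'\<in>?X. \<Sum>b\<in>?X. pmf p (a', b) * of_bool (Q (a', b) \<and> a' = a))"
      unfolding prob sum.cartesian_product by (intro sum.cong) auto
    also have "\<dots> = (\<Sum>a'\<in>?X. if a' = a then \<Sum>b\<in>?X. pmf p (a, b) * of_bool (Q (a, b)) else 0)"
      by (intro sum.cong) auto
    finally show ?thesis using that finX by simp
  qed
  have snd_sum: "measure_pmf.prob p {z. Q z \<and> snd z = b} = (\<Sum>a\<in>?X. pmf p (a, b) * of_bool (Q (a, b)))" if "b \<in> ?X" for b Q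
  proof -
    have "measure_pmf.prob p {z. Q z \<and> snd z = b} = (\<Sum>b'\<in>?X. \<Sum>a\<in>?X. pmf p (a, b') * of_bool (Q (a, b') \<and> b' = b))"
      unfolding prob by (subst sum.swap, unfold sum.cartesian_product) (intro sum.cong, auto)
    also have "\<dots> = (\<Sum>b'\<in>?X. if b' = b then \<Sum>a\<in>?X. pmf p (a, b) * of_bool (Q (a, b)) else 0)"
      by (intro sum.cong) auto
    finally show ?thesis using that finX by simp
  qed
  have "real (formula_complexity {..<m} f) - 1 \<le>
      128 * real m ^ 4 * (1 / v0 * (1 / v1)) * (1 + real (depth \<phi>))\<^sup>2 * leaves \<phi>"
  proof (rule composition_bound[OF f p _ _ _ _ \<phi>])
    show "(\<Sum>b\<in>?X. pmf p (a, b) * of_bool (a j \<noteq> b j)) \<le> 1 / v1 * (\<Sum>b\<in>?X. pmf p (a, b))" if "a \<in> ?X" "j < n" for a j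
      using v1(3)[of j a] that fst_sum[of a "\<lambda>z. fst z j \<noteq> snd z j"] fst_sum[of a "\<lambda>_. True"] by simp
    show "(\<Sum>a\<in>?X. pmf p (a, b) * of_bool (a j \<noteq> b j)) \<le> 1 / v0 * (\<Sum>a\<in>?X. pmf p (a, b))" if "b \<in> ?X" "j < n" for b j
      using v0(3)[of j b] that snd_sum[of b "\<lambda>z. fst z j \<noteq> snd z j"] snd_sum[of b "\<lambda>_. True"] by simp
  qed (use v0(1) v1(1) in auto)
  hence "(real (formula_complexity {..<m} f) - 1) * (v1 * v0) \<le> 128 * real m ^ 4 * (1 + real (depth \<phi>))\<^sup>2 * leaves \<phi>"
    using v0(1) v1(1) by (simp add: field_simps)
  moreover have "soft_adv_value {..<n} p = ereal (v1 * v0)"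
    unfolding soft_adv_value_def v1(2) v0(2) by simp
  ultimately show ?thesis using that by blast
qed

section \<open>Choice of parameters and conclusion\<close>

text \<open>With \<open>x = s * ln 2 / 2\<close> one has
  \<open>4 * x \<le> (1 + x)\<^sup>2 \<le> exp (2 * x)\<close>, and \<open>s \<le> 4 * x\<close>
  because \<open>2 * ln 2 \<ge> 1\<close>.\<close>

lemma le_two_powr: "s \<le> 2 powr s" if "s \<ge> 0" for s :: real
proof -
  have "s * 1 \<le> s * (2 * ln 2)" using ln2_ge_two_thirds that by (intro mult_left_mono) auto
  hence "s \<le> 4 * (s * ln 2 / 2)" by simp
  also have "\<dots> \<le> (1 + s * ln 2 / 2)\<^sup>2" using sum_squares_ge_zero[of "1 - s * ln 2 / 2" 0]
    by (simp add: power2_eq_square algebra_simps)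
  also have "\<dots> \<le> (exp (s * ln 2 / 2))\<^sup>2" using that by (intro power_mono exp_ge_add_one_self) auto
  also have "\<dots> = 2 powr s" by (simp add: powr_def power2_eq_square exp_add[symmetric])
  finally show ?thesis .
qed

text \<open>With \<open>s = sqrt (log 2 L)\<close>, \<open>k = 2 powr s\<close> and
  \<open>\<epsilon> = 1 / s\<close> one has \<open>k powr \<epsilon> = 2\<close> and
  \<open>L powr \<epsilon> = k\<close>. The size is then at most \<open>L * k\<close>, and one plus
  the depth at most \<open>4 * k ^ 3\<close> because
  \<open>ln L \<le> s\<^sup>2 \<le> k\<^sup>2\<close>; together this is
  \<open>16 * L * k ^ 7\<close>, whence the 7.\<close>

lemma balanced_size_bound:
  fixes \<phi> :: "'v formula"
  defines "L \<equiv> real (leaves \<phi>)"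
  obtains \<psi> where "equivalent \<phi> \<psi>" "(1 + real (depth \<psi>))\<^sup>2 * real (leaves \<psi>) \<le> 16 * L powr (1 + 7 / sqrt (log 2 L))"
proof (cases "leaves \<phi> = 1")
  \<comment> \<open>Here \<open>log 2 L = 0\<close> and the quotient in the exponent is 0 by
    convention; powers of 1 are 1 anyway.\<close>
  case True
  obtain \<psi> where "equivalent \<phi> \<psi>" "real (leaves \<psi>) \<le> 1" "real (depth \<psi>) \<le> 0"
    using formula_balancing[of 2 1 \<phi>] True by auto
  thus ?thesis using that[of \<psi>] True by (simp add: L_def)
next
  case False
  hence L: "L \<ge> 2" using leaves_pos[of \<phi>] unfolding L_def by linarith
  define s where "s = sqrt (log 2 L)"
  define k where "k = 2 powr s"
  have logL: "log 2 L \<ge> 1" using L by (simp add: le_log_iff)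
  hence s: "s \<ge> 1" "s\<^sup>2 = log 2 L" by (simp_all add: s_def)
  have k: "k \<ge> 2" using powr_mono[of 1 s 2] s by (simp add: k_def)
  have Lk: "L powr (1 / s) = k"
  proof -
    have "L = 2 powr (s * s)" using s L by (simp add: power2_eq_square[symmetric])
    hence "L powr (1 / s) = 2 powr (s * s * (1 / s))" by (simp only: powr_powr)
    thus ?thesis using s by (simp add: k_def)
  qed
  have "k powr (1 / s) = 2" using s by (simp add: k_def powr_powr)
  then obtain \<psi> where \<psi>: "equivalent \<phi> \<psi>" "real (leaves \<psi>) \<le> L * k" "real (depth \<psi>) \<le> 3 * k * ln L"
    using formula_balancing[of k "1 / s" \<phi>] k s Lk unfolding L_def by auto
  have "ln L = log 2 L * ln 2" by (simp add: log_def)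
  also have "\<dots> \<le> s\<^sup>2" using s logL ln_2_less_1 by (simp add: mult_left_le)
  also have "s\<^sup>2 \<le> k\<^sup>2" using le_two_powr[of s] s by (intro power_mono) (auto simp: k_def)
  finally have "3 * k * ln L \<le> 3 * k * k\<^sup>2" using k by (intro mult_left_mono) auto
  moreover have "1 \<le> k ^ 3" using k by simp
  ultimately have "1 + real (depth \<psi>) \<le> 4 * k ^ 3" using \<psi>(3) by (simp add: eval_nat_numeral mult_ac)
  hence "(1 + real (depth \<psi>))\<^sup>2 * real (leaves \<psi>) \<le> (4 * k ^ 3)\<^sup>2 * (L * k)"
    using \<psi>(2) by (intro mult_mono power_mono) auto
  also have "\<dots> = 16 * (L * k ^ 7)" by (simp add: eval_nat_numeral)
  also have "k ^ 7 = L powr (7 / s)" unfolding Lk[symmetric] using L by (simp add: powr_power)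
  also have "L * L powr (7 / s) = L powr (1 + 7 / s)" using L by (simp add: powr_add)
  finally show ?thesis using that[of \<psi>] \<psi>(1) by (simp add: s_def)
qed

theorem theorem7p1:
  "\<exists>C\<^sub>1 C\<^sub>2 C\<^sub>3 :: real. C\<^sub>1 > 0 \<and> C\<^sub>2 > 0 \<and> C\<^sub>3 > 0 \<and>
     (\<forall>(m :: nat) (n :: nat) (f :: (nat \<Rightarrow> bool) \<Rightarrow> bool) (g :: (nat \<Rightarrow> bool) \<Rightarrow> bool).
        \<not> f constant_on cube {..<m} \<longrightarrow> \<not> g constant_on cube {..<n} \<longrightarrow>
        (let L = real (formula_complexity ({..<m} \<times> {..<n}) (block_comp m n f g)) in
           ereal (L powr (1 + C\<^sub>1 / sqrt (log 2 L)))
             \<ge> ereal (1 / (C\<^sub>2 * real m ^ 4) * (real (formula_complexity {..<m} f) - C\<^sub>3)) * soft_adv {..<n} g))"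
proof (rule exI[of _ 7], rule exI[of _ 2048], rule exI[of _ 1], intro conjI allI impI)
  \<comment> \<open>The 7 is from \<open>balanced_size_bound\<close>, and 2048 is 128 * 16, from
    \<open>soft_adv_value_composition_bound\<close> and \<open>balanced_size_bound\<close>.\<close>
  fix m n :: nat and f g :: "(nat \<Rightarrow> bool) \<Rightarrow> bool"
  assume f: "\<not> f constant_on cube {..<m}" and g: "\<not> g constant_on cube {..<n}"
  note m = nonconstant_cube_pos[OF f] and n = nonconstant_cube_pos[OF g]
  define L where "L = real (formula_complexity ({..<m} \<times> {..<n}) (block_comp m n f g))"
  define R where "R = L powr (1 + 7 / sqrt (log 2 L))"
  define c where "c = 1 / (2048 * real m ^ 4) * (real (formula_complexity {..<m} f) - 1)"
  obtain \<phi> where \<phi>: "computes ({..<m} \<times> {..<n}) \<phi> (block_comp m n f g)"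
    "leaves \<phi> = formula_complexity ({..<m} \<times> {..<n}) (block_comp m n f g)"
    using formula_complexity_attained[of "{..<m} \<times> {..<n}" "block_comp m n f g"] m n by auto
  obtain \<psi> where \<psi>: "equivalent \<phi> \<psi>" "(1 + real (depth \<psi>))\<^sup>2 * real (leaves \<psi>) \<le> 16 * R"
    using balanced_size_bound[of \<phi>] unfolding \<phi>(2) R_def L_def by blast
  have comp: "computes ({..<m} \<times> {..<n}) \<psi> (block_comp m n f g)"
    using \<phi>(1) \<psi>(1) by (auto simp: computes_def equivalent_def)
  have bound: "ereal c * soft_adv_value {..<n} p \<le> ereal R"
    if p: "set_pmf p \<subseteq> {a \<in> cube {..<n}. g a} \<times> {b \<in> cube {..<n}. \<not> g b}" for p
  proof -
    obtain v where v: "soft_adv_value {..<n} p = ereal v"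
      "(real (formula_complexity {..<m} f) - 1) * v \<le> 128 * real m ^ 4 * (1 + real (depth \<psi>))\<^sup>2 * leaves \<psi>"
      using soft_adv_value_composition_bound[OF f p comp] by blast
    note v(2)
    also have "128 * real m ^ 4 * (1 + real (depth \<psi>))\<^sup>2 * leaves \<psi> \<le> 128 * real m ^ 4 * (16 * R)"
      unfolding mult.assoc[of "128 * real m ^ 4"] by (intro mult_left_mono \<psi>(2)) simp
    finally have "c * v \<le> R" using m by (simp add: c_def field_simps)
    thus ?thesis by (simp add: v(1))
  qed
  obtain \<eta> where "computes {..<m} \<eta> f" "leaves \<eta> = formula_complexity {..<m} f"
    using formula_complexity_attained[of "{..<m}" f] m by auto
  \<comment> \<open>Formulas have at least one leaf, so subtracting 1 keeps \<open>c\<close>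
    nonnegative.\<close>
  hence "c \<ge> 0" using leaves_pos[of \<eta>] by (simp add: c_def)
  have "ereal c * soft_adv {..<n} g \<le> ereal R"
  \<comment> \<open>For \<open>c = 0\<close> the product is 0 whatever the supremum is; for
    \<open>c > 0\<close> dividing by \<open>c\<close> carries the bound over to the
    supremum.\<close>
  proof (cases "c = 0")
    case True
    thus ?thesis by (simp add: R_def flip: zero_ereal_def)
  next
    case False
    with \<open>c \<ge> 0\<close> have "c > 0" by simp
    have "soft_adv {..<n} g \<le> ereal R / ereal c" unfolding soft_adv_def
    proof (rule SUP_least)
      fix p assume "p \<in> {p. set_pmf p \<subseteq> {a \<in> cube {..<n}. g a} \<times> {b \<in> cube {..<n}. \<not> g b}}"
      with bound[of p] show "soft_adv_value {..<n} p \<le> ereal R / ereal c"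
        using \<open>c > 0\<close> by (subst ereal_le_divide_pos) auto
    qed
    thus ?thesis using \<open>c > 0\<close> by (subst (asm) ereal_le_divide_pos) auto
  qed
  thus "let L = real (formula_complexity ({..<m} \<times> {..<n}) (block_comp m n f g)) in
      ereal (1 / (2048 * real m ^ 4) * (real (formula_complexity {..<m} f) - 1)) * soft_adv {..<n} g
      \<le> ereal (L powr (1 + 7 / sqrt (log 2 L)))"
    unfolding Let_def c_def R_def L_def .
qed auto

end
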